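(* Let $(X,d,\mu)$ be a space of homogeneous type, let $s\ge 0$, and let $F$ be a closed subset of $X$. Let $H^s$ denote the $s$-dimensional Hausdorff measure relative to $\mu$, and let $H^s|_F$ denote its restriction to $F$, i.e. $H^s|_F(E)=H^s(E\cap F)$. If $F$ is an $s$-set in $(X,d,\mu)$ with some measure $m$, then $F$ is an $s$-set in $(X,d,\mu)$ with the measure $H^s|_F$. Likewise, if $F$ is locally an $s$-set in $(X,d,\mu)$ with some measure $m$, then $F$ is locally an $s$-set in $(X,d,\mu)$ with the measure $H^s|_F$.
   Context: A quasi-metric on a set $X$ is a function $d:X\times X\to[0,\infty)$ with $d(x,y)=0$ iff $x=y$, $d(x,y)=d(y,x)$, and $d(x,y)\le K(d(x,z)+d(z,y))$ for all $x,y,z\in X$, for some constant $K\ge 1$ (the triangle constant of $d$). Write $B(x,r)=\{y\in X: d(x,y)<r\}$, $r>0$, for the $d$-balls. The topology on $X$ is the one induced by $d$: its neighborhood system is given by the sets containing a $d$-ball; it is assumed that the $d$-balls are open sets. For $E\subseteq X$, $\mathrm{diam}(E)=\sup\{d(x,y):x,y\in E\}$. A Borel measure $\mu$ is doubling if there is a constant $A\ge 1$ with $0<\mu(B(x,2r))\le A\mu(B(x,r))<\infty$ for all $x\in X$, $r>0$; it is non-atomic if $\mu(\{x\})=0$ for all $x\in X$. $(X,d,\mu)$ is a space of homogeneous type if $\mu$ is a non-atomic doubling measure on the quasi-metric space $(X,d)$. A closed set $F\subseteq X$ is an $s$-set in $(X,d,\mu)$ with measure $m$ if $m$ is a Borel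 measure supported on $F$ and there is a constant $c\ge 1$ such that $c^{-1}\mu(B(x,r))^s\le m(B(x,r))\le c\,\mu(B(x,r))^s$ for every $x\in F$ and every $0<r<\mathrm{diam}(F)$. It is locally an $s$-set in $(X,d,\mu)$ with measure $m$ if these inequalities hold for every $x\in F$ and every $0<r<r_0$, for some positive number $r_0<\mathrm{diam}(F)$. The $s$-dimensional Hausdorff measure relative to $\mu$ is $H^s(E)=\lim_{\rho\to 0}H^s_\rho(E)$, where $H^s_\rho(E)=\inf\left\{\sum_{i}\mu(B_i)^s : E\subseteq\bigcup_i B_i \text{ and } \mu(B_i)\le\rho \text{ for all } i\right\}$, the infimum being over finite or countable families of $d$-balls $B_i$ in $X$. *)

theory Defs
  imports "HOL-Analysis.Analysis"
begin

text \<open>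
  The underlying set \<open>X\<close> is a carrier set in an arbitrary type; the type carries no topology of its
  own. Only the values of \<open>d\<close> on \<open>X \<times> X\<close> and the values of a measure on Borel sets matter.
\<close>

definition quasi_metric :: "'a set \<Rightarrow> ('a \<Rightarrow> 'a \<Rightarrow> real) \<Rightarrow> bool" where
  "quasi_metric X d \<longleftrightarrow>
     (\<forall>x\<in>X. \<forall>y\<in>X. 0 \<le> d x y \<and> (d x y = 0 \<longleftrightarrow> x = y) \<and> d x y = d y x) \<and>
     (\<exists>K\<ge>1. \<forall>x\<in>X. \<forall>y\<in>X. \<forall>z\<in>X. d x y \<le> K * (d x z + d z y))"

definition qball :: "'a set \<Rightarrow> ('a \<Rightarrow> 'a \<Rightarrow> real) \<Rightarrow> 'a \<Rightarrow> real \<Rightarrow> 'a set" where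
  "qball X d x r = {y \<in> X. d x y < r}"

definition qtopology :: "'a set \<Rightarrow> ('a \<Rightarrow> 'a \<Rightarrow> real) \<Rightarrow> 'a topology" where
  "qtopology X d = topology (\<lambda>U. U \<subseteq> X \<and> (\<forall>x\<in>U. \<exists>r>0. qball X d x r \<subseteq> U))"

lemma openin_qtopology:
  "openin (qtopology X d) U \<longleftrightarrow> U \<subseteq> X \<and> (\<forall>x\<in>U. \<exists>r>0. qball X d x r \<subseteq> U)"
proof -
  have "istopology (\<lambda>U. U \<subseteq> X \<and> (\<forall>x\<in>U. \<exists>r>0. qball X d x r \<subseteq> U))"
    unfolding istopology_def
  proof (intro conjI allI impI)
    fix S T
    assume S: "S \<subseteq> X \<and> (\<forall>x\<in>S. \<exists>r>0. qball X d x r \<subseteq> S)"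
      and T: "T \<subseteq> X \<and> (\<forall>x\<in>T. \<exists>r>0. qball X d x r \<subseteq> T)"
    show "S \<inter> T \<subseteq> X" using S by blast
    show "\<forall>x\<in>S \<inter> T. \<exists>r>0. qball X d x r \<subseteq> S \<inter> T"
    proof
      fix x assume "x \<in> S \<inter> T"
      then obtain r t where "r > 0" "qball X d x r \<subseteq> S" "t > 0" "qball X d x t \<subseteq> T"
        using S T by blast
      then show "\<exists>r>0. qball X d x r \<subseteq> S \<inter> T"
        by (intro exI[of _ "min r t"]) (auto simp: qball_def)
    qed
  next
    fix \<U> :: "'a set set"
    assume U: "\<forall>U\<in>\<U>. U \<subseteq> X \<and> (\<forall>x\<in>U. \<exists>r>0. qball X d x r \<subseteq> U)"
    show "\<Union>\<U> \<subseteq> X" using U by blast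
    show "\<forall>x\<in>\<Union>\<U>. \<exists>r>0. qball X d x r \<subseteq> \<Union>\<U>"
    proof
      fix x assume "x \<in> \<Union>\<U>"
      then obtain U r where "U \<in> \<U>" "r > 0" "qball X d x r \<subseteq> U" using U by blast
      then show "\<exists>r>0. qball X d x r \<subseteq> \<Union>\<U>" by blast
    qed
  qed
  then show ?thesis
    by (simp add: qtopology_def topology_inverse')
qed

lemma topspace_qtopology: "topspace (qtopology X d) = X"
proof -
  have "\<exists>r>0. qball X d x r \<subseteq> X" for x
    by (rule exI[of _ 1]) (simp add: qball_def)
  then have "openin (qtopology X d) X"
    by (simp add: openin_qtopology)
  then have "X \<subseteq> topspace (qtopology X d)"
    by (rule openin_subset)
  moreover have "topspace (qtopology X d) \<subseteq> X"
    using openin_topspace[of "qtopology X d"] unfolding openin_qtopology by (rule conjunct1)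
  ultimately show ?thesis by (rule subset_antisym[rotated])
qed

definition qdiam :: "('a \<Rightarrow> 'a \<Rightarrow> real) \<Rightarrow> 'a set \<Rightarrow> ennreal" where
  "qdiam d E = (SUP x\<in>E. SUP y\<in>E. ennreal (d x y))"

definition borel_sets :: "'a set \<Rightarrow> ('a \<Rightarrow> 'a \<Rightarrow> real) \<Rightarrow> 'a set set" where
  "borel_sets X d = sigma_sets X {U. openin (qtopology X d) U}"

text \<open>
  Measures are set functions that need only be meaningful on Borel sets. This avoids
  \<^const>\<open>measure_of\<close>, which returns the zero measure when the given function is not countably
  additive.
\<close>

definition borel_measure :: "'a set \<Rightarrow> ('a \<Rightarrow> 'a \<Rightarrow> real) \<Rightarrow> ('a set \<Rightarrow> ennreal) \<Rightarrow> bool" where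
  "borel_measure X d m \<longleftrightarrow> measure_space X (borel_sets X d) m"

definition doubling :: "'a set \<Rightarrow> ('a \<Rightarrow> 'a \<Rightarrow> real) \<Rightarrow> ('a set \<Rightarrow> ennreal) \<Rightarrow> bool" where
  "doubling X d \<mu> \<longleftrightarrow>
     (\<exists>A\<ge>1::real. \<forall>x\<in>X. \<forall>r>0.
        0 < \<mu> (qball X d x (2 * r)) \<and>
        \<mu> (qball X d x (2 * r)) \<le> ennreal A * \<mu> (qball X d x r) \<and>
        ennreal A * \<mu> (qball X d x r) < \<infinity>)"

definition homogeneous_type :: "'a set \<Rightarrow> ('a \<Rightarrow> 'a \<Rightarrow> real) \<Rightarrow> ('a set \<Rightarrow> ennreal) \<Rightarrow> bool" where
  "homogeneous_type X d \<mu> \<longleftrightarrow>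
     quasi_metric X d \<and>
     (\<forall>x\<in>X. \<forall>r>0. openin (qtopology X d) (qball X d x r)) \<and>
     borel_measure X d \<mu> \<and>
     doubling X d \<mu> \<and>
     (\<forall>x\<in>X. \<mu> {x} = 0)"

text \<open>
  \<open>\<mu>(B)\<^sup>s\<close>. It is only used for balls \<open>B\<close>, where \<open>0 < \<mu>(B) < \<infinity>\<close> by doubling, so the conventions
  \<open>enn2real \<infinity> = 0\<close> and \<open>0 powr 0 = 0\<close> play no role.
\<close>

definition mpow :: "('a set \<Rightarrow> ennreal) \<Rightarrow> real \<Rightarrow> 'a set \<Rightarrow> ennreal" where
  "mpow \<mu> s B = ennreal (enn2real (\<mu> B) powr s)"

definition s_bounds ::
  "'a set \<Rightarrow> ('a \<Rightarrow> 'a \<Rightarrow> real) \<Rightarrow> ('a set \<Rightarrow> ennreal) \<Rightarrow> real \<Rightarrow> ('a set \<Rightarrow> ennreal) \<Rightarrow> real \<Rightarrow> 'a \<Rightarrow> real \<Rightarrow> bool"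
where
  "s_bounds X d \<mu> s m c x r \<longleftrightarrow>
     ennreal (inverse c) * mpow \<mu> s (qball X d x r) \<le> m (qball X d x r) \<and>
     m (qball X d x r) \<le> ennreal c * mpow \<mu> s (qball X d x r)"

definition s_set ::
  "'a set \<Rightarrow> ('a \<Rightarrow> 'a \<Rightarrow> real) \<Rightarrow> ('a set \<Rightarrow> ennreal) \<Rightarrow> real \<Rightarrow> 'a set \<Rightarrow> ('a set \<Rightarrow> ennreal) \<Rightarrow> bool"
where
  "s_set X d \<mu> s F m \<longleftrightarrow>
     closedin (qtopology X d) F \<and> borel_measure X d m \<and> m (X - F) = 0 \<and>
     (\<exists>c\<ge>1. \<forall>x\<in>F. \<forall>r>0. ennreal r < qdiam d F \<longrightarrow> s_bounds X d \<mu> s m c x r)"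

definition local_s_set ::
  "'a set \<Rightarrow> ('a \<Rightarrow> 'a \<Rightarrow> real) \<Rightarrow> ('a set \<Rightarrow> ennreal) \<Rightarrow> real \<Rightarrow> 'a set \<Rightarrow> ('a set \<Rightarrow> ennreal) \<Rightarrow> bool"
where
  "local_s_set X d \<mu> s F m \<longleftrightarrow>
     closedin (qtopology X d) F \<and> borel_measure X d m \<and> m (X - F) = 0 \<and>
     (\<exists>r\<^sub>0>0. ennreal r\<^sub>0 < qdiam d F \<and>
        (\<exists>c\<ge>1. \<forall>x\<in>F. \<forall>r>0. r < r\<^sub>0 \<longrightarrow> s_bounds X d \<mu> s m c x r))"

text \<open>
  Finite or countable families of balls are indexed by subsets \<open>I\<close> of \<^typ>\<open>nat\<close>. For \<open>s = 0\<close> every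
  ball contributes \<open>1\<close>, so finite families cannot be padded to sequences.
\<close>

definition hausdorff_pre ::
  "'a set \<Rightarrow> ('a \<Rightarrow> 'a \<Rightarrow> real) \<Rightarrow> ('a set \<Rightarrow> ennreal) \<Rightarrow> real \<Rightarrow> real \<Rightarrow> 'a set \<Rightarrow> ennreal"
where
  "hausdorff_pre X d \<mu> s \<rho> E =
     Inf {\<Sum>\<^sub>\<infinity>i\<in>I. mpow \<mu> s (qball X d (x i) (r i)) | (I :: nat set) x r.
       (\<forall>i\<in>I. x i \<in> X \<and> 0 < r i \<and> \<mu> (qball X d (x i) (r i)) \<le> ennreal \<rho>) \<and>
       E \<subseteq> (\<Union>i\<in>I. qball X d (x i) (r i))}"

definition hausdorff ::
  "'a set \<Rightarrow> ('a \<Rightarrow> 'a \<Rightarrow> real) \<Rightarrow> ('a set \<Rightarrow> ennreal) \<Rightarrow> real \<Rightarrow> 'a set \<Rightarrow> ennreal"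
where
  "hausdorff X d \<mu> s E = Lim (at_right 0) (\<lambda>\<rho>. hausdorff_pre X d \<mu> s \<rho> E)"

lemma hausdorff_pre_antimono:
  assumes "\<rho> \<le> \<rho>'"
  shows "hausdorff_pre X d \<mu> s \<rho>' E \<le> hausdorff_pre X d \<mu> s \<rho> E"
proof -
  have *: "m \<le> ennreal \<rho> \<Longrightarrow> m \<le> ennreal \<rho>'" for m
    using assms by (meson ennreal_leI order_trans)
  show ?thesis
    unfolding hausdorff_pre_def by (intro Inf_superset_mono Collect_mono) (use * in blast)
qed

lemma hausdorff_pre_tendsto:
  "((\<lambda>\<rho>. hausdorff_pre X d \<mu> s \<rho> E) \<longlongrightarrow> (SUP \<rho>\<in>{0<..}. hausdorff_pre X d \<mu> s \<rho> E)) (at_right 0)"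
proof (rule order_tendstoI)
  fix a assume "a < (SUP \<rho>\<in>{0<..}. hausdorff_pre X d \<mu> s \<rho> E)"
  then obtain \<rho>' where \<rho>': "0 < \<rho>'" "a < hausdorff_pre X d \<mu> s \<rho>' E"
    by (auto simp: less_SUP_iff)
  show "\<forall>\<^sub>F \<rho> in at_right 0. a < hausdorff_pre X d \<mu> s \<rho> E"
    unfolding eventually_at_right_field
    using \<rho>' less_le_trans[OF \<rho>'(2) hausdorff_pre_antimono]
    by (intro exI[of _ \<rho>']) simp
next
  fix a assume a: "(SUP \<rho>\<in>{0<..}. hausdorff_pre X d \<mu> s \<rho> E) < a"
  show "\<forall>\<^sub>F \<rho> in at_right 0. hausdorff_pre X d \<mu> s \<rho> E < a"
    unfolding eventually_at_right_field
  proof (intro exI[of _ 1] conjI allI impI)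
    fix \<rho> :: real assume "0 < \<rho>"
    then have "hausdorff_pre X d \<mu> s \<rho> E \<le> (SUP \<rho>\<in>{0<..}. hausdorff_pre X d \<mu> s \<rho> E)"
      by (intro SUP_upper) simp
    then show "hausdorff_pre X d \<mu> s \<rho> E < a" using a by (rule le_less_trans)
  qed simp
qed

lemma hausdorff_eq_SUP:
  "hausdorff X d \<mu> s E = (SUP \<rho>\<in>{0<..}. hausdorff_pre X d \<mu> s \<rho> E)"
  unfolding hausdorff_def by (intro tendsto_Lim hausdorff_pre_tendsto) simp

end

theory Submission
  imports Defs
begin

text \<open>
  The doubling property makes the measures of two intersecting balls of comparable radii comparable.
  Hence in a covering of \<open>B(x,r) \<inter> F\<close> by balls of small measure every ball that matters has small
  radius and may be recentred in \<open>F\<close> at the cost of a constant, so that \<open>m(B) \<le> C \<mu>(B)\<^sup>s\<close>; summing gives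
  \<open>m(B(x,r)) \<le> C H\<^sup>s(B(x,r) \<inter> F)\<close>. Conversely, a maximal \<open>t\<close>-separated subset of \<open>B(x,r) \<inter> F\<close> yields a
  covering by balls of radius \<open>t\<close> whose shrunken copies are disjoint, so their \<open>\<mu>\<close>-measures to the power
  \<open>s\<close> add up to at most \<open>C m(B(x,2Kr))\<close>; since \<open>\<mu>\<close> has no atoms, the measures of these balls tend to
  \<open>0\<close> with \<open>t\<close>, uniformly on \<open>B(x,r)\<close>. That \<open>H\<^sup>s\<close> is a Borel measure follows from a variant of
  Caratheodory's criterion.
\<close>

subsection \<open>The Hausdorff outer measure\<close>

text \<open>
  \<^theory>\<open>HOL-Analysis.Infinite_Sum\<close> contains this fact only for functions of the form
  \<open>ennreal_of_enat \<circ> f\<close>: a coercion is inserted into its rule \<open>summable_on_ennreal\<close>.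
\<close>

lemma ennreal_summable_on [simp]: "(f :: 'b \<Rightarrow> ennreal) summable_on S"
  by (rule nonneg_summable_on_complete) simp

text \<open>Links the unordered sums in \<open>hausdorff_pre\<close> to series, the form in which
  countable subadditivity of a measure is available.\<close>

lemma infsum_nat_ennreal:
  fixes f :: "nat \<Rightarrow> ennreal"
  shows "(\<Sum>\<^sub>\<infinity>i\<in>I. f i) = (\<Sum>i. if i \<in> I then f i else 0)"
proof -
  have "(\<Sum>\<^sub>\<infinity>i\<in>I. f i) = (\<Sum>\<^sub>\<infinity>i. if i \<in> I then f i else 0)"
    by (rule infsum_cong_neutral) auto
  also have "\<dots> = (\<Sum>i. if i \<in> I then f i else 0)"
    by (intro sums_unique has_sum_imp_sums has_sum_infsum ennreal_summable_on)
  finally show ?thesis .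
qed

text \<open>A finite set of pairs meets finitely many fibres, each in a finite set, so its sum is at
  most a finite partial sum of the series on the right.\<close>

lemma infsum_Sigma_le_suminf:
  fixes f :: "nat \<times> 'b \<Rightarrow> ennreal"
  shows "(\<Sum>\<^sub>\<infinity>p\<in>Sigma UNIV J. f p) \<le> (\<Sum>n. \<Sum>\<^sub>\<infinity>j\<in>J n. f (n, j))"
proof (rule infsum_le_finite_sums)
  fix S assume S: "finite S" "S \<subseteq> Sigma UNIV J"
  define G where "G n = {j. (n, j) \<in> S}" for n
  have finG: "finite (G n)" for n
    unfolding G_def using S(1) by (rule finite_vimageI[unfolded vimage_def]) (auto simp: inj_on_def)
  have S_eq: "S = Sigma (fst ` S) G"
    by (force simp: G_def)
  have "sum f S = (\<Sum>n\<in>fst ` S. \<Sum>j\<in>G n. f (n, j))"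
    using S(1) finG by (subst sum.Sigma) (auto simp flip: S_eq)
  also have "\<dots> \<le> (\<Sum>n\<in>fst ` S. \<Sum>\<^sub>\<infinity>j\<in>J n. f (n, j))"
  proof (rule sum_mono)
    fix n
    have "G n \<subseteq> J n" using S(2) by (auto simp: G_def)
    then have "infsum (\<lambda>j. f (n, j)) (G n) \<le> infsum (\<lambda>j. f (n, j)) (J n)"
      by (intro infsum_mono_neutral) auto
    then show "(\<Sum>j\<in>G n. f (n, j)) \<le> (\<Sum>\<^sub>\<infinity>j\<in>J n. f (n, j))"
      using finG by simp
  qed
  also have "\<dots> \<le> (\<Sum>n. \<Sum>\<^sub>\<infinity>j\<in>J n. f (n, j))"
    using S(1) by (intro sum_le_suminf) auto
  finally show "sum f S \<le> (\<Sum>n. \<Sum>\<^sub>\<infinity>j\<in>J n. f (n, j))" .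
qed simp

section \<open>Covers and countable subadditivity\<close>

text \<open>Frees covers from the index type \<open>nat\<close> by transport along
  \<open>to_nat_on\<close>, so that pairs of indices or the centres of the balls can serve as
  indices.\<close>

lemma hausdorff_pre_le:
  assumes "countable J"
    and "\<And>j. j \<in> J \<Longrightarrow> x j \<in> X \<and> 0 < r j \<and> \<mu> (qball X d (x j) (r j)) \<le> ennreal \<rho>"
    and "E \<subseteq> (\<Union>j\<in>J. qball X d (x j) (r j))"
  shows "hausdorff_pre X d \<mu> s \<rho> E \<le> (\<Sum>\<^sub>\<infinity>j\<in>J. mpow \<mu> s (qball X d (x j) (r j)))"
proof -
  define h where "h = from_nat_into J"
  define g where "g = to_nat_on J"
  have inj: "inj_on g J" unfolding g_def using assms(1) by (rule inj_on_to_nat_on)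
  have hg: "h (g j) = j" if "j \<in> J" for j
    unfolding h_def g_def using assms(1) that by simp
  have "hausdorff_pre X d \<mu> s \<rho> E
      \<le> (\<Sum>\<^sub>\<infinity>i\<in>g ` J. mpow \<mu> s (qball X d (x (h i)) (r (h i))))"
    unfolding hausdorff_pre_def
  proof (rule Inf_lower, rule CollectI, intro exI conjI)
    show "\<forall>i\<in>g ` J. x (h i) \<in> X \<and> 0 < r (h i) \<and> \<mu> (qball X d (x (h i)) (r (h i))) \<le> ennreal \<rho>"
      using assms(2) hg by auto
    show "E \<subseteq> (\<Union>i\<in>g ` J. qball X d (x (h i)) (r (h i)))"
      using assms(3) hg by auto
  qed (rule refl)
  also have "\<dots> = (\<Sum>\<^sub>\<infinity>j\<in>J. mpow \<mu> s (qball X d (x j) (r j)))"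
    unfolding infsum_reindex[OF inj] by (rule infsum_cong) (simp add: hg)
  finally show ?thesis .
qed

lemma hausdorff_pre_less_cover:
  assumes "hausdorff_pre X d \<mu> s \<rho> E < a"
  obtains I :: "nat set" and x r
  where "\<And>i. i \<in> I \<Longrightarrow> x i \<in> X \<and> 0 < r i \<and> \<mu> (qball X d (x i) (r i)) \<le> ennreal \<rho>"
    and "E \<subseteq> (\<Union>i\<in>I. qball X d (x i) (r i))"
    and "(\<Sum>\<^sub>\<infinity>i\<in>I. mpow \<mu> s (qball X d (x i) (r i))) < a"
  using assms unfolding hausdorff_pre_def Inf_less_iff by blast

lemma hausdorff_pre_greatest:
  assumes "\<And>(I :: nat set) x r.
      (\<And>i. i \<in> I \<Longrightarrow> x i \<in> X \<and> 0 < r i \<and> \<mu> (qball X d (x i) (r i)) \<le> ennreal \<rho>) \<Longrightarrow>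
      E \<subseteq> (\<Union>i\<in>I. qball X d (x i) (r i)) \<Longrightarrow>
      a \<le> (\<Sum>\<^sub>\<infinity>i\<in>I. mpow \<mu> s (qball X d (x i) (r i)))"
  shows "a \<le> hausdorff_pre X d \<mu> s \<rho> E"
  unfolding hausdorff_pre_def by (rule Inf_greatest) (use assms in blast)

lemma hausdorff_pre_mono:
  "E \<subseteq> E' \<Longrightarrow> hausdorff_pre X d \<mu> s \<rho> E \<le> hausdorff_pre X d \<mu> s \<rho> E'"
  unfolding hausdorff_pre_def by (rule Inf_superset_mono) blast

lemma hausdorff_pre_le_hausdorff:
  "0 < \<rho> \<Longrightarrow> hausdorff_pre X d \<mu> s \<rho> E \<le> hausdorff X d \<mu> s E"
  unfolding hausdorff_eq_SUP by (rule SUP_upper) simp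

lemma hausdorff_least:
  assumes "\<And>\<rho>. 0 < \<rho> \<Longrightarrow> hausdorff_pre X d \<mu> s \<rho> E \<le> a"
  shows "hausdorff X d \<mu> s E \<le> a"
  unfolding hausdorff_eq_SUP by (rule SUP_least) (use assms in simp)

lemma hausdorff_mono: "E \<subseteq> E' \<Longrightarrow> hausdorff X d \<mu> s E \<le> hausdorff X d \<mu> s E'"
  by (rule hausdorff_least) (meson hausdorff_pre_mono hausdorff_pre_le_hausdorff order_trans)

lemma hausdorff_empty: "hausdorff X d \<mu> s {} = 0"
proof -
  have "hausdorff_pre X d \<mu> s \<rho> {} \<le> 0" for \<rho>
    using hausdorff_pre_le[of "{}" "\<lambda>_. undefined" X "\<lambda>_. 0" \<mu> d \<rho> "{}" s] by simp
  then have "hausdorff X d \<mu> s {} \<le> 0"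
    by (rule hausdorff_least)
  then show ?thesis by simp
qed

text \<open>Nearly optimal covers of the pieces, with errors \<open>e * (1/2) ^ Suc n\<close> that
  add up to \<open>e\<close>, are joined into one cover indexed by pairs.\<close>

lemma hausdorff_pre_UN_le:
  fixes E :: "nat \<Rightarrow> 'a set"
  shows "hausdorff_pre X d \<mu> s \<rho> (\<Union>n. E n) \<le> (\<Sum>n. hausdorff_pre X d \<mu> s \<rho> (E n))"
proof (rule ennreal_le_epsilon)
  fix e :: real
  assume fin: "(\<Sum>n. hausdorff_pre X d \<mu> s \<rho> (E n)) < top" and "0 < e"
  have "\<exists>I x r. (\<forall>i\<in>I. x i \<in> X \<and> 0 < r i \<and> \<mu> (qball X d (x i) (r i)) \<le> ennreal \<rho>) \<and>
      E n \<subseteq> (\<Union>i\<in>I. qball X d (x i) (r i)) \<and>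
      (\<Sum>\<^sub>\<infinity>i\<in>(I::nat set). mpow \<mu> s (qball X d (x i) (r i)))
        \<le> hausdorff_pre X d \<mu> s \<rho> (E n) + ennreal (e * (1/2) ^ Suc n)" (is "\<exists>I x r. ?P n I x r") for n
  proof -
    \<comment> \<open>Finiteness makes the addition of a positive term strict, so a cover this close
      to the infimum exists.\<close>
    have "hausdorff_pre X d \<mu> s \<rho> (E n) < top"
      using fin by (rule ennreal_suminf_lessD)
    then have "hausdorff_pre X d \<mu> s \<rho> (E n)
        < hausdorff_pre X d \<mu> s \<rho> (E n) + ennreal (e * (1/2) ^ Suc n)"
      using \<open>0 < e\<close>
        ennreal_add_left_cancel_less[of "hausdorff_pre X d \<mu> s \<rho> (E n)" 0 "ennreal (e * (1/2) ^ Suc n)"]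
      by (simp add: ennreal_less_zero_iff del: ennreal_add_left_cancel_less)
    then show ?thesis
    proof (rule hausdorff_pre_less_cover, goal_cases)
      case (1 I x r)
      then show ?thesis by (intro exI[of _ I] exI[of _ x] exI[of _ r]) (simp add: less_imp_le)
    qed
  qed
  then have "\<forall>n. \<exists>I x r. ?P n I x r" by (rule allI)
  then obtain I x r where P: "\<And>n. ?P n (I n) (x n) (r n)"
    unfolding choice_iff by blast
  have "hausdorff_pre X d \<mu> s \<rho> (\<Union>n. E n)
      \<le> (\<Sum>\<^sub>\<infinity>p\<in>Sigma UNIV I. mpow \<mu> s (qball X d (x (fst p) (snd p)) (r (fst p) (snd p))))"
  proof (rule hausdorff_pre_le)
    show "(\<Union>n. E n) \<subseteq> (\<Union>p\<in>Sigma UNIV I. qball X d (x (fst p) (snd p)) (r (fst p) (snd p)))"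
    proof
      fix z assume "z \<in> (\<Union>n. E n)"
      then obtain n where "z \<in> E n" by blast
      then obtain i where "i \<in> I n" "z \<in> qball X d (x n i) (r n i)" using P[of n] by blast
      then show "z \<in> (\<Union>p\<in>Sigma UNIV I. qball X d (x (fst p) (snd p)) (r (fst p) (snd p)))"
        by (intro UN_I[of "(n, i)"]) auto
    qed
  qed (use P in auto)
  also have "\<dots> \<le> (\<Sum>n. \<Sum>\<^sub>\<infinity>i\<in>I n. mpow \<mu> s (qball X d (x n i) (r n i)))"
    using infsum_Sigma_le_suminf[of "\<lambda>p. mpow \<mu> s (qball X d (x (fst p) (snd p)) (r (fst p) (snd p)))" I]
    by simp
  also have "\<dots> \<le> (\<Sum>n. hausdorff_pre X d \<mu> s \<rho> (E n) + ennreal (e * (1/2) ^ Suc n))"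
    using P by (intro suminf_le) auto
  also have "\<dots> = (\<Sum>n. hausdorff_pre X d \<mu> s \<rho> (E n)) + (\<Sum>n. ennreal (e * (1/2) ^ Suc n))"
    by (rule suminf_add[symmetric]) auto
  also have "(\<Sum>n. ennreal (e * (1/2) ^ Suc n)) = ennreal e"
  proof -
    have "(\<lambda>n. e * (1/2) ^ Suc n) sums (e * 1)"
      by (intro sums_mult power_half_series)
    then show ?thesis
      using \<open>0 < e\<close> by (intro suminf_ennreal_eq) auto
  qed
  finally show "hausdorff_pre X d \<mu> s \<rho> (\<Union>n. E n) \<le> (\<Sum>n. hausdorff_pre X d \<mu> s \<rho> (E n)) + ennreal e" .
qed

lemma hausdorff_UN_le:
  fixes E :: "nat \<Rightarrow> 'a set"
  shows "hausdorff X d \<mu> s (\<Union>n. E n) \<le> (\<Sum>n. hausdorff X d \<mu> s (E n))"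
proof (rule hausdorff_least)
  fix \<rho> :: real assume "0 < \<rho>"
  then have "(\<Sum>n. hausdorff_pre X d \<mu> s \<rho> (E n)) \<le> (\<Sum>n. hausdorff X d \<mu> s (E n))"
    by (intro suminf_le hausdorff_pre_le_hausdorff) auto
  with hausdorff_pre_UN_le show "hausdorff_pre X d \<mu> s \<rho> (\<Union>n. E n) \<le> (\<Sum>n. hausdorff X d \<mu> s (E n))"
    by (rule order_trans)
qed

lemma outer_measure_space_hausdorff: "outer_measure_space (Pow X) (hausdorff X d \<mu> s)"
  unfolding outer_measure_space_def
  by (auto simp: positive_def increasing_def countably_subadditive_def hausdorff_empty
      intro: hausdorff_mono hausdorff_UN_le)

lemma hausdorff_finite_UN_le:
  assumes "finite S"
  shows "hausdorff X d \<mu> s (\<Union>z\<in>S. E z) \<le> (\<Sum>z\<in>S. hausdorff X d \<mu> s (E z))"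
  using assms
proof (induction S)
  case (insert z S)
  \<comment> \<open>Padding with empty sets is harmless even for \<open>s = 0\<close>, because the
    empty family covers the empty set at cost 0.\<close>
  have "hausdorff X d \<mu> s (\<Union>z\<in>insert z S. E z)
      = hausdorff X d \<mu> s (\<Union>n. if n = (0::nat) then E z else if n = 1 then (\<Union>z\<in>S. E z) else {})"
    by (rule arg_cong[where f="hausdorff X d \<mu> s"]) (auto split: if_splits intro: exI[of _ "0::nat"] exI[of _ "Suc 0"])
  also have "\<dots> \<le> (\<Sum>n. hausdorff X d \<mu> s (if n = (0::nat) then E z else if n = 1 then (\<Union>z\<in>S. E z) else {}))"
    by (rule hausdorff_UN_le)
  also have "\<dots> = (\<Sum>n\<in>{0,1}. hausdorff X d \<mu> s (if n = (0::nat) then E z else if n = 1 then (\<Union>z\<in>S. E z) else {}))"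
    by (rule suminf_finite) (auto simp: hausdorff_empty)
  also have "\<dots> = hausdorff X d \<mu> s (E z) + hausdorff X d \<mu> s (\<Union>z\<in>S. E z)"
    by simp
  also have "\<dots> \<le> (\<Sum>z\<in>insert z S. hausdorff X d \<mu> s (E z))"
    using insert by (simp add: add_left_mono)
  finally show ?case .
qed (simp add: hausdorff_empty)

section \<open>Separated sets and the limit step of Caratheodory's criterion\<close>

text \<open>At scales below \<open>\<rho>0\<close> no ball of a cover meets both sets, so a cover of
  the union contains two disjoint subfamilies, one covering each set. This condition takes the place
  of positive distance.\<close>

lemma hausdorff_superadditive:
  assumes "0 < \<rho>0"
    and sep: "\<And>x r. x \<in> X \<Longrightarrow> 0 < r \<Longrightarrow> \<mu> (qball X d x r) \<le> ennreal \<rho>0 \<Longrightarrow>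
      qball X d x r \<inter> A = {} \<or> qball X d x r \<inter> B = {}"
  shows "hausdorff X d \<mu> s A + hausdorff X d \<mu> s B \<le> hausdorff X d \<mu> s (A \<union> B)"
proof -
  let ?H = "hausdorff_pre X d \<mu> s"
  have le: "?H \<rho> A + ?H \<rho> B \<le> hausdorff X d \<mu> s (A \<union> B)" if \<rho>: "0 < \<rho>" "\<rho> < \<rho>0" for \<rho>
  proof -
    have "?H \<rho> A + ?H \<rho> B \<le> ?H \<rho> (A \<union> B)"
    proof (rule hausdorff_pre_greatest)
      fix I :: "nat set" and x r
      assume I: "\<And>i. i \<in> I \<Longrightarrow> x i \<in> X \<and> 0 < r i \<and> \<mu> (qball X d (x i) (r i)) \<le> ennreal \<rho>"
        and cov: "A \<union> B \<subseteq> (\<Union>i\<in>I. qball X d (x i) (r i))"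
      define IA where "IA = {i\<in>I. qball X d (x i) (r i) \<inter> A \<noteq> {}}"
      define IB where "IB = {i\<in>I. qball X d (x i) (r i) \<inter> B \<noteq> {}}"
      have disj: "IA \<inter> IB = {}"
      proof -
        have "\<mu> (qball X d (x i) (r i)) \<le> ennreal \<rho>0" if "i \<in> I" for i
          using I[OF that] \<rho> by (meson ennreal_leI less_imp_le order_trans)
        then show ?thesis using sep I unfolding IA_def IB_def by blast
      qed
      let ?f = "\<lambda>i. mpow \<mu> s (qball X d (x i) (r i))"
      have "?H \<rho> A \<le> (\<Sum>\<^sub>\<infinity>i\<in>IA. ?f i)"
        using I cov by (intro hausdorff_pre_le) (auto simp: IA_def, blast)
      moreover have "?H \<rho> B \<le> (\<Sum>\<^sub>\<infinity>i\<in>IB. ?f i)"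
        using I cov by (intro hausdorff_pre_le) (auto simp: IB_def, blast)
      ultimately have "?H \<rho> A + ?H \<rho> B \<le> (\<Sum>\<^sub>\<infinity>i\<in>IA. ?f i) + (\<Sum>\<^sub>\<infinity>i\<in>IB. ?f i)"
        by (rule add_mono)
      also have "\<dots> = (\<Sum>\<^sub>\<infinity>i\<in>IA \<union> IB. ?f i)"
        using disj by (intro infsum_Un_disjoint[symmetric] ennreal_summable_on) auto
      also have "\<dots> \<le> (\<Sum>\<^sub>\<infinity>i\<in>I. ?f i)"
        by (rule infsum_mono_neutral) (auto simp: IA_def IB_def)
      finally show "?H \<rho> A + ?H \<rho> B \<le> (\<Sum>\<^sub>\<infinity>i\<in>I. ?f i)" .
    qed
    also have "\<dots> \<le> hausdorff X d \<mu> s (A \<union> B)"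
      using \<rho>(1) by (rule hausdorff_pre_le_hausdorff)
    finally show ?thesis .
  qed
  have "((\<lambda>\<rho>. ?H \<rho> A + ?H \<rho> B) \<longlongrightarrow> hausdorff X d \<mu> s A + hausdorff X d \<mu> s B) (at_right 0)"
    unfolding hausdorff_eq_SUP by (intro tendsto_add hausdorff_pre_tendsto)
  moreover have "\<forall>\<^sub>F \<rho> in at_right 0. ?H \<rho> A + ?H \<rho> B \<le> hausdorff X d \<mu> s (A \<union> B)"
    unfolding eventually_at_right_field using le \<open>0 < \<rho>0\<close> by blast
  ultimately show ?thesis
    by (rule tendsto_upperbound) simp
qed

text \<open>Rings \<open>R n\<close> of equal parity are separated, so the values on them add up. If
  the supremum is finite, the ring values form a convergent series, and the union consists of one
  \<open>T (Suc N)\<close> and rings of small total value.\<close>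

lemma SUP_separated_increasing:
  fixes f :: "'a set \<Rightarrow> ennreal" and T :: "nat \<Rightarrow> 'a set"
  assumes empty: "f {} = 0"
    and mono: "\<And>A B. A \<subseteq> B \<Longrightarrow> f A \<le> f B"
    and csub: "\<And>E :: nat \<Rightarrow> 'a set. f (\<Union>n. E n) \<le> (\<Sum>n. f (E n))"
    and inc: "incseq T"
    and sep: "\<And>n A B. A \<subseteq> T n \<Longrightarrow> B \<inter> T (Suc n) = {} \<Longrightarrow> B \<subseteq> (\<Union>k. T k) \<Longrightarrow> f A + f B \<le> f (A \<union> B)"
  shows "f (\<Union>n. T n) \<le> (SUP n. f (T n))"
proof (cases "(SUP n. f (T n)) = top")
  case False
  define S where "S = (SUP n. f (T n))"
  define R where "R n = T (Suc n) - T n" for n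
  have TS: "f (T n) \<le> S" for n unfolding S_def by (rule SUP_upper) simp
  have T_mono: "i \<le> j \<Longrightarrow> T i \<subseteq> T j" for i j using inc by (rule incseqD)
  define a where "a k = f (R (Suc k))" for k
  have add: "f (T m) + f (R (Suc m)) \<le> f (T (Suc (Suc m)))" for m
  proof -
    have "f (T m) + f (R (Suc m)) \<le> f (T m \<union> R (Suc m))"
      by (rule sep[of _ m]) (auto simp: R_def)
    also have "\<dots> \<le> f (T (Suc (Suc m)))"
      using T_mono[of m "Suc (Suc m)"] by (intro mono) (auto simp: R_def)
    finally show ?thesis .
  qed
  \<comment> \<open>Even and odd indices are summed separately: the even ones accumulate in
    \<open>T (2 * n)\<close>, the odd ones in \<open>T (Suc (2 * n))\<close>.\<close>
  have "(\<Sum>k<2 * n. a k) \<le> f (T (2 * n)) + f (T (Suc (2 * n)))" for n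
  proof (induction n)
    case (Suc n)
    have "(\<Sum>k<2 * Suc n. a k) = (\<Sum>k<2 * n. a k) + a (2 * n) + a (Suc (2 * n))"
      by simp
    also have "\<dots> \<le> (f (T (2 * n)) + a (2 * n)) + (f (T (Suc (2 * n))) + a (Suc (2 * n)))"
      using Suc by (simp add: add_ac add_left_mono)
    also have "\<dots> \<le> f (T (2 * Suc n)) + f (T (Suc (2 * Suc n)))"
      using add[of "2 * n"] add[of "Suc (2 * n)"] by (simp add: a_def add_mono)
    finally show ?case .
  qed simp
  then have "(\<Sum>k<2 * n. a k) \<le> S + S" for n
    by (meson TS add_mono order_trans)
  moreover have "(\<Sum>k<n. a k) \<le> (\<Sum>k<2 * n. a k)" for n
    by (rule sum_mono2) auto
  ultimately have "(\<Sum>k. a k) \<le> S + S"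
    by (intro suminf_le_const) (auto intro: order_trans)
  moreover have "S + S \<noteq> top" using False by (simp add: S_def)
  ultimately have fin: "(\<Sum>k. a k) < top"
    by (metis top.not_eq_extremum top_unique)
  \<comment> \<open>A real copy of the finite values \<open>a k\<close>, since
    \<open>suminf_exist_split\<close> speaks of series in normed spaces.\<close>
  define b where "b k = enn2real (a k)" for k
  have ab: "a k = ennreal (b k)" for k
    unfolding b_def using ennreal_suminf_lessD[OF fin, of k] by simp
  have b0: "0 \<le> b k" for k by (simp add: b_def)
  have summ: "summable b"
    using fin by (intro summable_suminf_not_top) (auto simp: b0 ab)
  have "f (\<Union>n. T n) \<le> S"
  proof (rule ennreal_le_epsilon)
    fix e :: real assume "0 < e"
    from suminf_exist_split[OF this summ] obtain N
      where N: "norm (\<Sum>i. b (i + N)) < e" by blast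
    \<comment> \<open>The rings listed are exactly those beyond \<open>T (Suc N)\<close>; the shift
      matches the tail \<open>b (i + N)\<close>.\<close>
    define E where "E n = (case n of 0 \<Rightarrow> T (Suc N) | Suc k \<Rightarrow> R (Suc (k + N)))" for n
    have cover: "T n \<subseteq> (\<Union>k. E k)" for n
    proof (induction n)
      case 0
      have "T 0 \<subseteq> E 0" using T_mono[of 0 "Suc N"] by (simp add: E_def)
      then show ?case by blast
    next
      case (Suc n)
      show ?case
      proof (cases "n \<le> N")
        case True
        then have "T (Suc n) \<subseteq> E 0" using T_mono[of "Suc n" "Suc N"] by (simp add: E_def)
        then show ?thesis by blast
      next
        case False
        then obtain k where "n = Suc (k + N)"
          using less_imp_Suc_add[of N n] by (auto simp: add.commute)
        then have "R n = E (Suc k)" by (simp add: E_def)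
        then show ?thesis using Suc by (auto simp: R_def)
      qed
    qed
    have "f (\<Union>n. T n) \<le> f (\<Union>k. E k)"
      using cover by (intro mono) blast
    also have "\<dots> \<le> (\<Sum>k. f (E k))" by (rule csub)
    also have "\<dots> = f (T (Suc N)) + (\<Sum>k. a (k + N))"
      by (subst suminf_offset[where i=1]) (auto simp: E_def a_def)
    also have "(\<Sum>k. a (k + N)) = ennreal (\<Sum>k. b (k + N))"
      unfolding ab using summ by (intro suminf_ennreal2) (auto simp: b0 summable_iff_shift)
    also have "\<dots> \<le> ennreal e"
      using N by (intro ennreal_leI) auto
    also have "f (T (Suc N)) \<le> S" by (rule TS)
    finally show "f (\<Union>n. T n) \<le> S + ennreal e"
      by (simp add: add_mono)
  qed
  then show ?thesis by (simp only: S_def)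
qed (simp only: top_greatest)

subsection \<open>Spaces of homogeneous type\<close>

text \<open>Makes the \<open>emeasure\<close> library available for a bare set function, on the
  Borel sets only.\<close>

lemma borel_measureE:
  assumes "borel_measure X d m"
  obtains N where "sets N = borel_sets X d" "\<And>E. E \<in> borel_sets X d \<Longrightarrow> emeasure N E = m E"
proof -
  have ms: "sigma_algebra X (borel_sets X d)" "positive (borel_sets X d) m"
    "countably_additive (borel_sets X d) m"
    using assms by (auto simp: borel_measure_def measure_space_def)
  interpret sigma_algebra X "borel_sets X d" by fact
  show thesis
  proof (rule that[of "measure_of X (borel_sets X d) m"])
    show "sets (measure_of X (borel_sets X d) m) = borel_sets X d"
      using space_closed sigma_sets_eq by (subst sets_measure_of) auto
  qed (rule emeasure_measure_of_sigma[OF ms])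
qed

lemma sigma_algebra_borel_sets: "sigma_algebra X (borel_sets X d)"
  unfolding borel_sets_def
  by (rule sigma_algebra_sigma_sets) (auto simp: openin_qtopology)

lemma openin_borel_sets: "openin (qtopology X d) U \<Longrightarrow> U \<in> borel_sets X d"
  unfolding borel_sets_def by (rule sigma_sets.Basic) simp

lemma closedin_borel_sets:
  assumes "closedin (qtopology X d) C"
  shows "C \<in> borel_sets X d"
proof -
  interpret sigma_algebra X "borel_sets X d" by (rule sigma_algebra_borel_sets)
  have "X - (X - C) \<in> borel_sets X d"
    using assms by (intro compl_sets openin_borel_sets) (simp add: closedin_def topspace_qtopology)
  moreover have "C \<subseteq> X" using assms by (simp add: closedin_def topspace_qtopology)
  ultimately show ?thesis by (simp add: double_diff)
qed

lemma borel_measure_restrict: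
  assumes "borel_measure X d m" and "F \<in> borel_sets X d"
  shows "borel_measure X d (\<lambda>E. m (E \<inter> F))"
proof -
  interpret sigma_algebra X "borel_sets X d" by (rule sigma_algebra_borel_sets)
  have pos: "positive (borel_sets X d) m" and ca: "countably_additive (borel_sets X d) m"
    using assms(1) by (auto simp: borel_measure_def measure_space_def)
  have "countably_additive (borel_sets X d) (\<lambda>E. m (E \<inter> F))"
    unfolding countably_additive_def
  proof (intro allI impI)
    fix E :: "nat \<Rightarrow> 'a set"
    assume E: "range E \<subseteq> borel_sets X d" "disjoint_family E" "(\<Union>n. E n) \<in> borel_sets X d"
    have "(\<Sum>n. m (E n \<inter> F)) = m (\<Union>n. E n \<inter> F)"
      using E assms(2)
      by (intro ca[unfolded countably_additive_def, rule_format])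
        (auto simp: disjoint_family_on_def simp flip: UN_simps)
    then show "(\<Sum>n. m (E n \<inter> F)) = m ((\<Union>n. E n) \<inter> F)" by simp
  qed
  then show ?thesis
    using pos sigma_algebra_borel_sets by (auto simp: borel_measure_def measure_space_def positive_def)
qed

section \<open>Balls and the doubling property\<close>

text \<open>Fixes the constants that \<open>homogeneous_type\<close> only asserts to exist:
  \<open>K\<close> from the triangle inequality and \<open>A\<close> from doubling.\<close>

locale homogeneous_space =
  fixes X :: "'a set" and d :: "'a \<Rightarrow> 'a \<Rightarrow> real" and \<mu> :: "'a set \<Rightarrow> ennreal" and K A :: real
  assumes dist_self: "x \<in> X \<Longrightarrow> d x x = 0"
    and dist_eq_0: "x \<in> X \<Longrightarrow> y \<in> X \<Longrightarrow> d x y = 0 \<Longrightarrow> x = y"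
    and dist_nonneg: "x \<in> X \<Longrightarrow> y \<in> X \<Longrightarrow> 0 \<le> d x y"
    and dist_sym: "x \<in> X \<Longrightarrow> y \<in> X \<Longrightarrow> d x y = d y x"
    and K_ge_1: "1 \<le> K"
    and triangle: "x \<in> X \<Longrightarrow> y \<in> X \<Longrightarrow> z \<in> X \<Longrightarrow> d x y \<le> K * (d x z + d z y)"
    and openin_qball: "x \<in> X \<Longrightarrow> 0 < r \<Longrightarrow> openin (qtopology X d) (qball X d x r)"
    and borel_measure_\<mu>: "borel_measure X d \<mu>"
    and A_ge_1: "1 \<le> A"
    and ball_pos: "x \<in> X \<Longrightarrow> 0 < r \<Longrightarrow> 0 < \<mu> (qball X d x r)"
    and ball_finite: "x \<in> X \<Longrightarrow> 0 < r \<Longrightarrow> \<mu> (qball X d x r) < top"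
    and ball_doubling: "x \<in> X \<Longrightarrow> 0 < r \<Longrightarrow> \<mu> (qball X d x (2 * r)) \<le> ennreal A * \<mu> (qball X d x r)"
    and atomless: "x \<in> X \<Longrightarrow> \<mu> {x} = 0"
begin

abbreviation B :: "'a \<Rightarrow> real \<Rightarrow> 'a set" where "B \<equiv> qball X d"

text \<open>Real valued so that division and \<open>powr\<close> apply; for balls of positive radius
  nothing is lost, as their measure is finite.\<close>

definition vol :: "'a \<Rightarrow> real \<Rightarrow> real" where "vol x r = enn2real (\<mu> (B x r))"

lemma qball_borel: "x \<in> X \<Longrightarrow> 0 < r \<Longrightarrow> B x r \<in> borel_sets X d"
  by (rule openin_borel_sets[OF openin_qball])

lemma measure_ball: "x \<in> X \<Longrightarrow> 0 < r \<Longrightarrow> \<mu> (B x r) = ennreal (vol x r)"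
  using ball_finite by (simp add: vol_def)

lemma vol_pos: "x \<in> X \<Longrightarrow> 0 < r \<Longrightarrow> 0 < vol x r"
  using ball_pos[of x r] by (simp add: measure_ball)

lemma mpow_ball: "mpow \<mu> s (B x r) = ennreal (vol x r powr s)"
  by (simp add: mpow_def vol_def)

lemma vol_mono:
  assumes "B x r \<subseteq> B y t" "x \<in> X" "0 < r" "y \<in> X" "0 < t"
  shows "vol x r \<le> vol y t"
proof -
  obtain N where N: "sets N = borel_sets X d" "\<And>E. E \<in> borel_sets X d \<Longrightarrow> emeasure N E = \<mu> E"
    using borel_measureE[OF borel_measure_\<mu>] by blast
  have "\<mu> (B x r) \<le> \<mu> (B y t)"
    using emeasure_mono[OF assms(1), of N] qball_borel assms N by auto
  then show ?thesis
    using assms vol_pos[of y t] by (simp add: measure_ball ennreal_le_iff)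
qed

lemma vol_double: "x \<in> X \<Longrightarrow> 0 < r \<Longrightarrow> vol x (2 * r) \<le> A * vol x r"
  using ball_doubling[of x r] A_ge_1 vol_pos[of x r]
  by (simp add: measure_ball ennreal_mult[symmetric] ennreal_le_iff)

lemma vol_dyadic: "x \<in> X \<Longrightarrow> 0 < r \<Longrightarrow> vol x (2 ^ n * r) \<le> A ^ n * vol x r"
proof (induction n)
  case (Suc n)
  have "vol x (2 ^ Suc n * r) \<le> A * vol x (2 ^ n * r)"
    using vol_double[of x "2 ^ n * r"] Suc.prems by (simp add: mult.assoc)
  also have "\<dots> \<le> A ^ Suc n * vol x r"
    using Suc A_ge_1 by (simp add: mult.assoc mult_left_mono)
  finally show ?case .
qed simp

lemma ball_mono: "r \<le> t \<Longrightarrow> B x r \<subseteq> B x t"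
  by (auto simp: qball_def)

lemma ball_center: "x \<in> X \<Longrightarrow> 0 < r \<Longrightarrow> x \<in> B x r"
  by (simp add: qball_def dist_self)

lemma in_ball_sym: "x \<in> X \<Longrightarrow> y \<in> B x r \<Longrightarrow> x \<in> B y r"
  by (auto simp: qball_def dist_sym)

text \<open>Doubling is iterated until \<open>2 ^ n\<close> exceeds \<open>Q\<close>. The constant
  is uniform over all balls.\<close>

lemma dilate:
  assumes "0 < Q"
  obtains M where "1 \<le> M" "\<And>x r. x \<in> X \<Longrightarrow> 0 < r \<Longrightarrow> vol x (Q * r) \<le> M * vol x r"
proof -
  obtain n where n: "Q < 2 ^ n" using real_arch_pow[of 2 Q] by auto
  have "vol x (Q * r) \<le> A ^ n * vol x r" if "x \<in> X" "0 < r" for x r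
  proof -
    have "vol x (Q * r) \<le> vol x (2 ^ n * r)"
      using that assms n by (intro vol_mono ball_mono) auto
    with vol_dyadic[OF that] show ?thesis by (meson order_trans)
  qed
  then show thesis using that[of "A ^ n"] A_ge_1 by simp
qed

text \<open>Two triangle inequalities through a common point \<open>z\<close> give
  \<open>d y u < K * (t + 2 * K * r)\<close>, and both terms are absorbed into a multiple of
  \<open>t\<close>.\<close>

lemma ball_subset_dilate:
  assumes "x \<in> X" "y \<in> X" "0 < r" "0 < t" "B x r \<inter> B y t \<noteq> {}" "1 \<le> Q" "r \<le> Q * t"
  shows "B x r \<subseteq> B y (3 * K\<^sup>2 * Q * t)"
proof
  fix u assume u: "u \<in> B x r"
  obtain z where z: "z \<in> B x r" "z \<in> B y t" using assms(5) by blast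
  have X: "u \<in> X" "z \<in> X" using u z by (auto simp: qball_def)
  have "d z u \<le> K * (d z x + d x u)" using triangle X assms by blast
  also have "\<dots> \<le> K * (r + r)"
    using u z K_ge_1 X assms dist_sym[of x z] by (intro mult_left_mono add_mono) (auto simp: qball_def)
  finally have "d z u \<le> 2 * K * r" by simp
  have "d y u \<le> K * (d y z + d z u)" using triangle X assms by blast
  also have "\<dots> < K * (t + 2 * K * r)"
    using z K_ge_1 \<open>d z u \<le> 2 * K * r\<close> by (intro mult_strict_left_mono) (auto simp: qball_def)
  also have "\<dots> \<le> K * (K * Q * t + 2 * K * (Q * t))"
  proof -
    have "1 \<le> K * Q" using mult_mono[of 1 K 1 Q] K_ge_1 assms(6) by simp
    then have "1 * t \<le> (K * Q) * t" using assms(4) by (intro mult_right_mono) auto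
    then show ?thesis using K_ge_1 assms(7) by (intro mult_left_mono add_mono) auto
  qed
  also have "\<dots> = 3 * K\<^sup>2 * Q * t" by (simp add: power2_eq_square algebra_simps)
  finally show "u \<in> B y (3 * K\<^sup>2 * Q * t)" using X by (simp add: qball_def)
qed

text \<open>The first ball lies in a fixed dilate of the second. Only an upper bound of
  \<open>r\<close> by \<open>t\<close> enters, so the estimate is one-sided and \<open>M\<close>
  depends on \<open>Q\<close> alone.\<close>

lemma comparable:
  assumes "1 \<le> Q"
  obtains M where "1 \<le> M"
    "\<And>x y r t. x \<in> X \<Longrightarrow> y \<in> X \<Longrightarrow> 0 < r \<Longrightarrow> 0 < t \<Longrightarrow> B x r \<inter> B y t \<noteq> {} \<Longrightarrow> r \<le> Q * t \<Longrightarrow>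
      vol x r \<le> M * vol y t"
proof -
  obtain M where M: "1 \<le> M"
    "\<And>x r. x \<in> X \<Longrightarrow> 0 < r \<Longrightarrow> vol x ((3 * K\<^sup>2 * Q) * r) \<le> M * vol x r"
    using dilate[of "3 * K\<^sup>2 * Q"] assms K_ge_1 by auto
  show thesis
  proof (rule that[OF M(1)])
    fix x y r t
    assume *: "x \<in> X" "y \<in> X" "0 < r" "0 < t" "B x r \<inter> B y t \<noteq> {}" "r \<le> Q * t"
    have "vol x r \<le> vol y (3 * K\<^sup>2 * Q * t)"
      using * assms K_ge_1 by (intro vol_mono ball_subset_dilate) auto
    also have "\<dots> \<le> M * vol y t" using M(2) * by simp
    finally show "vol x r \<le> M * vol y t" .
  qed
qed

lemma engulf:
  obtains M where "1 \<le> M"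
    "\<And>x y r t \<rho>. x \<in> X \<Longrightarrow> y \<in> X \<Longrightarrow> 0 < r \<Longrightarrow> 0 < t \<Longrightarrow> B x r \<inter> B y t \<noteq> {} \<Longrightarrow>
      vol x r \<le> \<rho> \<Longrightarrow> vol y t \<le> \<rho> \<Longrightarrow>
      \<exists>z\<in>X. \<exists>u>0. B x r \<union> B y t \<subseteq> B z u \<and> vol z u \<le> M * \<rho>"
proof -
  obtain M where M: "1 \<le> M"
    "\<And>x r. x \<in> X \<Longrightarrow> 0 < r \<Longrightarrow> vol x ((3 * K\<^sup>2) * r) \<le> M * vol x r"
    using dilate[of "3 * K\<^sup>2"] K_ge_1 by auto
  have K2: "1 \<le> 3 * K\<^sup>2" using one_le_power[OF K_ge_1, of 2] by simp
  have main: "\<exists>z\<in>X. \<exists>u>0. B x r \<union> B y t \<subseteq> B z u \<and> vol z u \<le> M * \<rho>"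
    if "x \<in> X" "y \<in> X" "0 < r" "0 < t" "B x r \<inter> B y t \<noteq> {}" "vol y t \<le> \<rho>" "r \<le> t" for x y r t \<rho>
  proof (intro bexI exI conjI)
    have "1 * t \<le> 3 * K\<^sup>2 * t" using K2 that by (intro mult_right_mono) auto
    then have "B y t \<subseteq> B y (3 * K\<^sup>2 * t)" by (intro ball_mono) simp
    moreover have "B x r \<subseteq> B y (3 * K\<^sup>2 * t)" using ball_subset_dilate[of x y r t 1] that by simp
    ultimately show "B x r \<union> B y t \<subseteq> B y (3 * K\<^sup>2 * t)" by blast
    have "vol y (3 * K\<^sup>2 * t) \<le> M * vol y t" using M(2) that by simp
    also have "\<dots> \<le> M * \<rho>" using M(1) that by (intro mult_left_mono) auto
    finally show "vol y (3 * K\<^sup>2 * t) \<le> M * \<rho>" .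
    show "0 < 3 * K\<^sup>2 * t" using K2 that by (intro mult_pos_pos) auto
  qed fact
  show thesis
  proof (rule that[OF M(1)])
    fix x y r t \<rho>
    assume *: "x \<in> X" "y \<in> X" "0 < r" "0 < t" "B x r \<inter> B y t \<noteq> {}" "vol x r \<le> \<rho>" "vol y t \<le> \<rho>"
    show "\<exists>z\<in>X. \<exists>u>0. B x r \<union> B y t \<subseteq> B z u \<and> vol z u \<le> M * \<rho>"
      using main[of x y r t \<rho>] main[of y x t r \<rho>] * by (cases "r \<le> t") (auto simp: Un_commute Int_commute)
  qed
qed

section \<open>Measurability of closed sets\<close>

text \<open>If \<open>B x e\<close> misses \<open>C\<close>, a ball through \<open>x\<close> that
  reaches \<open>C\<close> has radius at least \<open>e / (2 * K)\<close>, so its measure is bounded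
  below by comparison with \<open>B x e\<close>.\<close>

lemma separation_from_closed:
  assumes "closedin (qtopology X d) C" "x \<in> X - C"
  obtains \<rho> where "0 < \<rho>"
    "\<And>y r. y \<in> X \<Longrightarrow> 0 < r \<Longrightarrow> x \<in> B y r \<Longrightarrow> B y r \<inter> C \<noteq> {} \<Longrightarrow> \<rho> \<le> vol y r"
proof -
  have "openin (qtopology X d) (X - C)"
    using assms(1) by (simp add: closedin_def topspace_qtopology)
  then obtain e where e: "0 < e" "B x e \<subseteq> X - C"
    using assms(2) by (auto simp: openin_qtopology)
  obtain M where M: "1 \<le> M"
    "\<And>x y r t. x \<in> X \<Longrightarrow> y \<in> X \<Longrightarrow> 0 < r \<Longrightarrow> 0 < t \<Longrightarrow> B x r \<inter> B y t \<noteq> {} \<Longrightarrow> r \<le> 2 * K * t \<Longrightarrow>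
      vol x r \<le> M * vol y t"
    using comparable[of "2 * K"] K_ge_1 by auto
  show thesis
  proof (rule that)
    show "0 < vol x e / M" using vol_pos[of x e] assms(2) e M(1) by simp
    fix y r
    assume *: "y \<in> X" "0 < r" "x \<in> B y r" "B y r \<inter> C \<noteq> {}"
    then obtain c where c: "c \<in> B y r" "c \<in> C" by blast
    have "c \<in> X" using c by (simp add: qball_def)
    then have "e \<le> d x c" using c e(2) by (auto simp: qball_def not_less[symmetric])
    also have "\<dots> \<le> K * (d x y + d y c)" using triangle assms(2) * \<open>c \<in> X\<close> by blast
    also have "\<dots> \<le> K * (r + r)"
      using * c K_ge_1 assms(2) dist_sym[of x y] by (intro mult_left_mono add_mono) (auto simp: qball_def)
    finally have "vol x e \<le> M * vol y r"
      using * assms(2) e(1) ball_center[of x e] by (intro M(2)) auto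
    then show "vol x e / M \<le> vol y r" using M(1) by (simp add: field_simps)
  qed
qed

text \<open>
  Balls may be small in measure without being small in radius, so \<open>H\<^sup>s\<close> need not be additive on sets at
  positive distance. Caratheodory's criterion is therefore run with separation measured by \<open>\<mu>\<close>: the
  closed set \<open>C\<close> is approximated from outside by the sets \<open>S n\<close> of points that share no ball of
  measure at most \<open>e n\<close> with \<open>C\<close>. By engulfing, \<open>S n\<close> is also separated from the complement of
  \<open>S (Suc n)\<close>.
\<close>

lemma hausdorff_closed_measurable:
  assumes C: "closedin (qtopology X d) C" and T: "T \<subseteq> X"
  shows "hausdorff X d \<mu> s (T \<inter> C) + hausdorff X d \<mu> s (T - C) = hausdorff X d \<mu> s T"
proof (rule antisym)
  let ?H = "hausdorff X d \<mu> s"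
  obtain M where M: "1 \<le> M"
    "\<And>x y r t \<rho>. x \<in> X \<Longrightarrow> y \<in> X \<Longrightarrow> 0 < r \<Longrightarrow> 0 < t \<Longrightarrow> B x r \<inter> B y t \<noteq> {} \<Longrightarrow>
      vol x r \<le> \<rho> \<Longrightarrow> vol y t \<le> \<rho> \<Longrightarrow>
      \<exists>z\<in>X. \<exists>u>0. B x r \<union> B y t \<subseteq> B z u \<and> vol z u \<le> M * \<rho>"
    using engulf by blast
  \<comment> \<open>\<open>M\<close> may equal 1, and \<open>L > 1\<close> is what makes
    \<open>e n\<close> tend to 0.\<close>
  define L where "L = M + 1"
  have L: "1 < L" "M \<le> L" using M(1) by (auto simp: L_def)
  define e where "e n = (1 / L) ^ n" for n
  have e_pos: "0 < e n" for n using L by (simp add: e_def)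
  have e_Suc: "M * e (Suc n) \<le> e n" for n
  proof -
    have "M * e (Suc n) \<le> L * e (Suc n)" using L e_pos[of "Suc n"] by (intro mult_right_mono) auto
    also have "\<dots> = e n" using L by (simp add: e_def field_simps)
    finally show ?thesis .
  qed
  have e_decr: "e (Suc n) \<le> e n" for n
  proof -
    have "1 * e (Suc n) \<le> M * e (Suc n)" using M(1) e_pos[of "Suc n"] by (intro mult_right_mono) auto
    with e_Suc[of n] show ?thesis by simp
  qed
  define S where "S n = {x \<in> T - C. \<forall>y\<in>X. \<forall>r>0. x \<in> B y r \<longrightarrow> B y r \<inter> C \<noteq> {} \<longrightarrow> e n < vol y r}" for n
  have SI: "(\<Union>n. S n) = T - C"
  proof (intro subset_antisym subsetI)
    fix x assume x: "x \<in> T - C"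
    then obtain \<rho> where \<rho>: "0 < \<rho>"
      "\<And>y r. y \<in> X \<Longrightarrow> 0 < r \<Longrightarrow> x \<in> B y r \<Longrightarrow> B y r \<inter> C \<noteq> {} \<Longrightarrow> \<rho> \<le> vol y r"
      using separation_from_closed[OF C, of x] T by blast
    obtain n where "e n < \<rho>"
      using real_arch_pow_inv[OF \<rho>(1), of "1 / L"] L by (auto simp: e_def)
    then have "x \<in> S n" using x \<rho>(2) by (force simp: S_def)
    then show "x \<in> (\<Union>n. S n)" by blast
  qed (auto simp: S_def)
  have inc: "incseq S"
    using le_less_trans[OF e_decr] by (intro incseq_SucI) (simp add: S_def Collect_mono_iff)
  have "?H (\<Union>n. S n) \<le> (SUP n. ?H (S n))"
  proof (rule SUP_separated_increasing[OF hausdorff_empty hausdorff_mono hausdorff_UN_le inc])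
    fix n U V
    assume U: "U \<subseteq> S n" and V: "V \<inter> S (Suc n) = {}" "V \<subseteq> (\<Union>k. S k)"
    show "?H U + ?H V \<le> ?H (U \<union> V)"
    proof (rule hausdorff_superadditive[OF e_pos[of "Suc n"]], rule ccontr)
      fix x r
      assume x: "x \<in> X" "0 < r" "\<mu> (B x r) \<le> ennreal (e (Suc n))"
        and "\<not> (B x r \<inter> U = {} \<or> B x r \<inter> V = {})"
      then obtain u v where u: "u \<in> B x r" "u \<in> U" and v: "v \<in> B x r" "v \<in> V" by blast
      have "v \<in> T - C" "v \<notin> S (Suc n)" using v V SI by auto
      then obtain y t where y: "y \<in> X" "0 < t" "v \<in> B y t" "B y t \<inter> C \<noteq> {}" "vol y t \<le> e (Suc n)"
        by (auto simp: S_def not_less)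
      have vol: "vol x r \<le> e (Suc n)"
        using x e_pos[of "Suc n"] by (simp add: measure_ball ennreal_le_iff)
      have meet: "B x r \<inter> B y t \<noteq> {}" using v(1) y(3) by blast
      \<comment> \<open>The engulfing ball contains \<open>u\<close> and meets \<open>C\<close>, but
        its measure is at most \<open>M * e (Suc n) \<le> e n\<close>, against
        \<open>u \<in> S n\<close>.\<close>
      obtain z w where z: "z \<in> X" "0 < w" "B x r \<union> B y t \<subseteq> B z w" "vol z w \<le> M * e (Suc n)"
        using M(2)[OF x(1) y(1) x(2) y(2) meet vol y(5)] by (elim bexE exE conjE)
      have "u \<in> S n" "u \<in> B z w" "B z w \<inter> C \<noteq> {}" using u U z(3) y(4) by blast+
      then have "e n < vol z w" using z(1,2) by (simp add: S_def)
      with z(4) e_Suc[of n] show False by simp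
    qed
  qed
  then have le: "?H (T - C) \<le> (SUP n. ?H (S n))" by (simp add: SI)
  have "?H (T \<inter> C) + ?H (S n) \<le> ?H T" for n
  proof -
    have "?H (T \<inter> C) + ?H (S n) \<le> ?H ((T \<inter> C) \<union> S n)"
    proof (rule hausdorff_superadditive[OF e_pos[of n]], rule ccontr)
      fix x r
      assume x: "x \<in> X" "0 < r" "\<mu> (B x r) \<le> ennreal (e n)"
        and "\<not> (B x r \<inter> (T \<inter> C) = {} \<or> B x r \<inter> S n = {})"
      then have "e n < vol x r" by (auto simp: S_def)
      with x e_pos[of n] show False by (simp add: measure_ball ennreal_le_iff)
    qed
    also have "\<dots> \<le> ?H T" by (rule hausdorff_mono) (auto simp: S_def)
    finally show ?thesis .
  qed
  then have "(SUP n. ?H (T \<inter> C) + ?H (S n)) \<le> ?H T" by (intro SUP_least)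
  then have "?H (T \<inter> C) + (SUP n. ?H (S n)) \<le> ?H T"
    by (subst (asm) ennreal_SUP_add_right[symmetric]) auto
  with le show "?H (T \<inter> C) + ?H (T - C) \<le> ?H T"
    by (meson add_left_mono order_trans)
  have "?H T \<le> ?H (\<Union>z\<in>{True, False}. if z then T \<inter> C else T - C)"
    by (rule hausdorff_mono) auto
  also have "\<dots> \<le> (\<Sum>z\<in>{True, False}. ?H (if z then T \<inter> C else T - C))"
    by (rule hausdorff_finite_UN_le) simp
  finally show "?H T \<le> ?H (T \<inter> C) + ?H (T - C)" by simp
qed

text \<open>The Caratheodory measurable sets form a sigma-algebra on which the outer measure is
  countably additive. It contains the closed sets, hence their complements and all Borel
  sets.\<close>

lemma borel_measure_hausdorff: "borel_measure X d (hausdorff X d \<mu> s)"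
proof -
  interpret P: sigma_algebra X "Pow X" by (rule sigma_algebra_Pow)
  let ?L = "lambda_system X (Pow X) (hausdorff X d \<mu> s)"
  have ms: "measure_space X ?L (hausdorff X d \<mu> s)"
    by (rule P.caratheodory_lemma[OF outer_measure_space_hausdorff])
  then interpret L: sigma_algebra X ?L by (simp add: measure_space_def)
  have "U \<in> ?L" if "openin (qtopology X d) U" for U
  proof -
    have U: "U \<subseteq> X" using that by (simp add: openin_qtopology)
    have "closedin (qtopology X d) (X - U)"
      using that U by (simp add: closedin_def topspace_qtopology double_diff)
    from hausdorff_closed_measurable[OF this, where s = s] have "X - U \<in> ?L"
      by (simp add: P.lambda_system_eq)
    then have "X - (X - U) \<in> ?L" by (rule L.compl_sets)
    then show ?thesis using U by (simp add: double_diff)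
  qed
  then have "borel_sets X d \<subseteq> ?L"
    unfolding borel_sets_def by (intro L.sigma_sets_subset) auto
  moreover have "countably_additive ?L (hausdorff X d \<mu> s)"
    using ms by (simp add: measure_space_def)
  ultimately have "countably_additive (borel_sets X d) (hausdorff X d \<mu> s)"
    unfolding countably_additive_def by (meson order_trans subsetD)
  then show ?thesis
    using sigma_algebra_borel_sets
    by (simp add: borel_measure_def measure_space_def positive_def hausdorff_empty)
qed

subsection \<open>Separated nets\<close>

lemma ball_subset_trans:
  assumes "x \<in> X" "z \<in> B x r" "K * (r + t) \<le> R"
  shows "B z t \<subseteq> B x R"
proof
  fix u assume u: "u \<in> B z t"
  have "d x u \<le> K * (d x z + d z u)" using triangle assms u by (simp add: qball_def)
  also have "\<dots> < K * (r + t)"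
    using assms u K_ge_1 by (intro mult_strict_left_mono) (auto simp: qball_def)
  finally show "u \<in> B x R" using u assms(3) by (simp add: qball_def)
qed

lemma sum_disjoint_balls_le:
  assumes m: "borel_measure X d m" and "finite S" "S \<subseteq> X" "0 < t" "x \<in> X" "0 < R"
    and "disjoint_family_on (\<lambda>z. B z t) S" and sub: "\<And>z. z \<in> S \<Longrightarrow> B z t \<subseteq> B x R"
  shows "(\<Sum>z\<in>S. m (B z t)) \<le> m (B x R)"
proof -
  obtain N where N: "sets N = borel_sets X d" "\<And>E. E \<in> borel_sets X d \<Longrightarrow> emeasure N E = m E"
    using borel_measureE[OF m] by blast
  have S: "B z t \<in> borel_sets X d" if "z \<in> S" for z
    using that assms by (intro qball_borel) auto
  have "(\<Sum>z\<in>S. m (B z t)) = (\<Sum>z\<in>S. emeasure N (B z t))"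
    using S N by (intro sum.cong) auto
  also have "\<dots> = emeasure N (\<Union>z\<in>S. B z t)"
    using S N assms by (intro sum_emeasure) auto
  also have "\<dots> \<le> emeasure N (B x R)"
    using sub N qball_borel assms by (intro emeasure_mono UN_least) auto
  finally show ?thesis using N qball_borel assms by simp
qed

text \<open>
  Otherwise balls \<open>B z\<^sub>n t\<^sub>n\<close> with \<open>t\<^sub>n \<rightarrow> 0\<close> of measure at least \<open>\<rho>\<close> inside a set of finite measure
  have a point \<open>p\<close> in their limit superior, and \<open>p\<close> is an atom. No completeness is needed.
\<close>

lemma vol_uniformly_small:
  assumes x: "x \<in> X" and \<rho>: "0 < \<rho>"
  shows "\<exists>t>0. \<forall>z\<in>B x r. vol z t < \<rho>"
proof (rule ccontr)
  assume neg: "\<not> ?thesis"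
  obtain N where N: "sets N = borel_sets X d" "\<And>E. E \<in> borel_sets X d \<Longrightarrow> emeasure N E = \<mu> E"
    using borel_measureE[OF borel_measure_\<mu>] by blast
  define \<tau> where "\<tau> n = inverse (real (Suc n))" for n
  have \<tau>_pos: "0 < \<tau> n" for n by (simp add: \<tau>_def)
  have \<tau>_mono: "\<tau> k \<le> \<tau> n" if "n \<le> k" for n k using that by (simp add: \<tau>_def)
  have "\<exists>z. z \<in> B x r \<and> \<rho> \<le> vol z (\<tau> n)" for n
    using neg \<tau>_pos[of n] by (meson not_less)
  then obtain z where z: "\<And>n. z n \<in> B x r" "\<And>n. \<rho> \<le> vol (z n) (\<tau> n)" by metis
  have zX: "z n \<in> X" for n using z(1)[of n] by (simp add: qball_def)
  have ball_sets: "B y t \<in> sets N" if "y \<in> X" "0 < t" for y t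
    using qball_borel that N by simp
  have em: "emeasure N (B y t) = ennreal (vol y t)" if "y \<in> X" "0 < t" for y t
    using N qball_borel measure_ball that by simp
  define U where "U n = (\<Union>k\<in>{n..}. B (z k) (\<tau> k))" for n
  have U_sets: "U n \<in> sets N" for n
    unfolding U_def using ball_sets zX \<tau>_pos by (intro sets.countable_UN') auto
  have dec: "decseq U" unfolding U_def by (intro decseq_SucI UN_mono) auto
  \<comment> \<open>The radius is arbitrary in the statement; a non-positive one is excluded because
    \<open>B x r\<close> contains \<open>z 0\<close>.\<close>
  have "0 < r" using z(1)[of 0] dist_nonneg[OF x zX[of 0]] by (auto simp: qball_def)
  define R where "R = K * (r + 1)"
  have "0 < R" using \<open>0 < r\<close> K_ge_1 by (simp add: R_def)
  have "B (z k) (\<tau> k) \<subseteq> B x R" for k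
    using x z(1) \<tau>_mono[of 0 k] K_ge_1
    by (intro ball_subset_trans[of x "z k" r]) (auto simp: R_def \<tau>_def intro!: mult_left_mono)
  then have "U n \<subseteq> B x R" for n by (auto simp: U_def)
  then have "emeasure N (U n) \<le> emeasure N (B x R)" for n
    using ball_sets x \<open>0 < R\<close> by (intro emeasure_mono) auto
  then have fin: "emeasure N (U n) \<noteq> \<infinity>" for n
    using em[OF x \<open>0 < R\<close>] by (metis ennreal_neq_top infinity_ennreal_def top_unique)
  have "ennreal \<rho> \<le> emeasure N (U n)" for n
  proof -
    have "ennreal \<rho> \<le> emeasure N (B (z n) (\<tau> n))"
      using z(2) em zX \<tau>_pos by (simp add: ennreal_leI)
    also have "\<dots> \<le> emeasure N (U n)" by (rule emeasure_mono[OF _ U_sets]) (auto simp: U_def)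
    finally show ?thesis .
  qed
  then have "ennreal \<rho> \<le> (INF n. emeasure N (U n))" by (intro INF_greatest)
  also have "\<dots> = emeasure N (\<Inter>n. U n)"
    using U_sets dec fin by (intro INF_emeasure_decseq) auto
  finally have "(\<Inter>n. U n) \<noteq> {}" using \<rho> by auto
  then obtain p where p: "\<And>n. p \<in> U n" by blast
  then have pX: "p \<in> X" by (auto simp: U_def qball_def)
  \<comment> \<open>Some ball \<open>B (z k) (\<tau> k)\<close> with \<open>k \<ge> n\<close>
    contains \<open>p\<close>; the factor \<open>2 * K\<close> makes \<open>V n\<close> contain that
    whole ball, hence have measure at least \<open>\<rho>\<close>.\<close>
  define V where "V n = B p (2 * K * \<tau> n)" for n
  have Kt: "0 < 2 * K * \<tau> n" for n using K_ge_1 \<tau>_pos[of n] by simp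
  have V_ge: "ennreal \<rho> \<le> emeasure N (V n)" for n
  proof -
    obtain k where k: "n \<le> k" "p \<in> B (z k) (\<tau> k)" using p[of n] by (auto simp: U_def)
    have "p \<in> B (z k) (\<tau> k)" "z k \<in> B p (\<tau> k)" using k zX pX by (auto intro: in_ball_sym)
    then have "B (z k) (\<tau> k) \<subseteq> B p (2 * K * \<tau> k)"
      using pX by (intro ball_subset_trans[of p "z k" "\<tau> k"]) auto
    also have "\<dots> \<subseteq> V n"
      unfolding V_def using \<tau>_mono[OF k(1)] K_ge_1 by (intro ball_mono mult_left_mono) auto
    finally have "vol (z k) (\<tau> k) \<le> vol p (2 * K * \<tau> n)"
      unfolding V_def using zX pX \<tau>_pos Kt by (intro vol_mono) auto
    then show ?thesis
      unfolding V_def using em[OF pX Kt[of n]] z(2)[of k] by (simp add: ennreal_leI)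
  qed
  have V_eq: "(\<Inter>n. V n) = {p}"
  proof (intro subset_antisym subsetI)
    fix u assume u: "u \<in> (\<Inter>n. V n)"
    then have uX: "u \<in> X" by (auto simp: V_def qball_def)
    have "d p u = 0"
    proof (rule ccontr)
      assume "d p u \<noteq> 0"
      then have "0 < d p u / (2 * K)" using dist_nonneg[OF pX uX] K_ge_1 by simp
      then obtain n where "inverse (real (Suc n)) < d p u / (2 * K)"
        using reals_Archimedean by blast
      then have "2 * K * \<tau> n < d p u" using K_ge_1 by (simp add: \<tau>_def field_simps)
      moreover have "u \<in> V n" using u by blast
      ultimately show False by (simp add: V_def qball_def)
    qed
    then show "u \<in> {p}" using dist_eq_0 pX uX by blast
  qed (use ball_center pX Kt in \<open>auto simp: V_def\<close>)
  have "ennreal \<rho> \<le> (INF n. emeasure N (V n))" using V_ge by (intro INF_greatest)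
  also have "\<dots> = emeasure N (\<Inter>n. V n)"
  proof (rule INF_emeasure_decseq)
    show "range V \<subseteq> sets N" using ball_sets pX Kt by (auto simp: V_def)
    show "decseq V"
      unfolding decseq_def V_def using \<tau>_mono K_ge_1 by (intro allI impI ball_mono mult_left_mono) auto
    show "emeasure N (V n) \<noteq> \<infinity>" for n unfolding V_def using em[OF pX Kt[of n]] by simp
  qed
  also have "\<dots> = \<mu> {p}"
  proof -
    have "(\<Inter>n. V n) \<in> sets N" using ball_sets pX Kt by (intro sets.countable_INT') (auto simp: V_def)
    then show ?thesis using N V_eq by simp
  qed
  finally show False using atomless[OF pX] \<rho> by simp
qed

text \<open>A \<open>t\<close>-separated set of greatest cardinality covers. The balls of radius
  \<open>t / (2 * K)\<close> about its points are disjoint, lie in one ball \<open>B x R\<close> and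
  each carry a fixed fraction of its measure, which bounds their number in terms of \<open>Q\<close>
  alone.\<close>

lemma net:
  assumes "1 \<le> Q"
  shows "\<exists>n. \<forall>x\<in>X. \<forall>r>0. \<forall>t>0. r \<le> Q * t \<longrightarrow> (\<forall>E\<subseteq>B x r.
    \<exists>S. finite S \<and> card S \<le> n \<and> S \<subseteq> E \<and> E \<subseteq> (\<Union>z\<in>S. B z t) \<and>
      disjoint_family_on (\<lambda>z. B z (t / (2 * K))) S)"
proof -
  \<comment> \<open>Chosen so that \<open>R = K * (r + t)\<close> is at most \<open>P * u\<close>
    for \<open>u = t / (2 * K)\<close>.\<close>
  define P where "P = 2 * K\<^sup>2 * (Q + 1)"
  have K2: "1 \<le> K\<^sup>2" using K_ge_1 by (rule one_le_power)
  have "1 * 1 \<le> (2 * K\<^sup>2) * (Q + 1)" using assms K2 by (intro mult_mono) auto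
  then have "1 \<le> P" by (simp add: P_def)
  then obtain M where M: "1 \<le> M"
    "\<And>x y r t. x \<in> X \<Longrightarrow> y \<in> X \<Longrightarrow> 0 < r \<Longrightarrow> 0 < t \<Longrightarrow> B x r \<inter> B y t \<noteq> {} \<Longrightarrow> r \<le> P * t \<Longrightarrow>
      vol x r \<le> M * vol y t"
    using comparable by metis
  show ?thesis
  proof (intro exI[of _ "nat \<lfloor>M\<rfloor>"] ballI allI impI)
    fix x r t E
    assume x: "x \<in> X" "0 < r" "0 < t" "r \<le> Q * t" and E: "E \<subseteq> B x r"
    define u where "u = t / (2 * K)"
    define R where "R = K * (r + t)"
    have u: "0 < u" using x K_ge_1 by (simp add: u_def)
    have R: "0 < R" using x K_ge_1 by (simp add: R_def)
    have "r \<le> R" using x K_ge_1 mult_mono[of 1 K r "r + t"] by (simp add: R_def)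
    have RP: "R \<le> P * u"
    proof -
      have "R \<le> K * (Q * t + t)" using x K_ge_1 by (simp add: R_def)
      also have "\<dots> = P * u" using K_ge_1 by (simp add: P_def u_def power2_eq_square field_simps)
      finally show ?thesis .
    qed
    define sep where "sep S \<longleftrightarrow> finite S \<and> S \<subseteq> E \<and> (\<forall>z\<in>S. \<forall>w\<in>S. z \<noteq> w \<longrightarrow> t \<le> d z w)" for S
    have disj: "disjoint_family_on (\<lambda>z. B z u) S" if "sep S" for S
      unfolding disjoint_family_on_def
    proof (intro ballI impI, rule ccontr)
      fix z w assume zw: "z \<in> S" "w \<in> S" "z \<noteq> w" "B z u \<inter> B w u \<noteq> {}"
      then obtain v where v: "v \<in> B z u" "v \<in> B w u" by blast
      have X: "z \<in> X" "w \<in> X" "v \<in> X" using zw v that E by (auto simp: sep_def qball_def)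
      have "d z w \<le> K * (d z v + d v w)" using triangle X by blast
      also have "\<dots> < K * (u + u)"
        using v K_ge_1 X dist_sym[of w v] by (intro mult_strict_left_mono) (auto simp: qball_def)
      also have "\<dots> = t" using K_ge_1 by (simp add: u_def)
      finally show False using that zw by (force simp: sep_def)
    qed
    have card: "card S \<le> nat \<lfloor>M\<rfloor>" if S: "sep S" for S
    proof -
      have SX: "S \<subseteq> X" and "finite S" using S E by (auto simp: sep_def qball_def)
      have sub: "B z u \<subseteq> B x R" if "z \<in> S" for z
      proof (rule ball_subset_trans[OF x(1), of _ r])
        show "z \<in> B x r" using that S E by (auto simp: sep_def)
        have "u \<le> t" using x K_ge_1 by (simp add: u_def field_simps mult_le_cancel_right1)
        then show "K * (r + u) \<le> R" using K_ge_1 by (simp add: R_def)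
      qed
      have vol: "vol x R / M \<le> vol z u" if "z \<in> S" for z
      proof -
        have "B x R \<inter> B z u \<noteq> {}" using sub[OF that] ball_center[of z u] SX u that by auto
        then have "vol x R \<le> M * vol z u" using that SX x R u RP by (intro M(2)) auto
        then show ?thesis using M(1) by (simp add: field_simps)
      qed
      have "ennreal (real (card S) * (vol x R / M)) = ennreal (\<Sum>z\<in>S. vol x R / M)" by simp
      also have "\<dots> = (\<Sum>z\<in>S. ennreal (vol x R / M))"
        using vol_pos[OF x(1) R] M(1) by (intro sum_ennreal[symmetric]) auto
      also have "\<dots> \<le> (\<Sum>z\<in>S. \<mu> (B z u))"
        using vol SX u by (intro sum_mono) (auto simp: measure_ball subset_iff intro!: ennreal_leI)
      also have "\<dots> \<le> \<mu> (B x R)"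
        using borel_measure_\<mu> \<open>finite S\<close> SX u x R disj[OF S] sub by (intro sum_disjoint_balls_le)
      also have "\<dots> = ennreal (vol x R)" using x R by (simp add: measure_ball)
      finally have "real (card S) * (vol x R / M) \<le> vol x R"
        using vol_pos[OF x(1) R] by (simp add: ennreal_le_iff)
      then have "real (card S) \<le> M"
        using vol_pos[OF x(1) R] M(1) by (simp add: field_simps)
      then show ?thesis by (simp add: le_nat_floor)
    qed
    \<comment> \<open>The uniform bound on cardinalities yields a separated set of greatest
      cardinality without a choice of maximal elements.\<close>
    have "sep {}" by (simp add: sep_def)
    then obtain S where S: "sep S" and max: "\<And>S'. sep S' \<Longrightarrow> card S' \<le> card S"
      using ex_has_greatest_nat[of sep "{}" card "Suc (nat \<lfloor>M\<rfloor>)"] card by (auto simp: less_Suc_eq_le)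
    have "E \<subseteq> (\<Union>z\<in>S. B z t)"
    proof (rule ccontr)
      assume "\<not> E \<subseteq> (\<Union>z\<in>S. B z t)"
      then obtain e where e: "e \<in> E" "\<And>z. z \<in> S \<Longrightarrow> e \<notin> B z t" by blast
      have X: "e \<in> X" "S \<subseteq> X" using e E S by (auto simp: sep_def qball_def)
      have "t \<le> d z e" "t \<le> d e z" if "z \<in> S" for z
        using e(2)[OF that] X that dist_sym[of e z] by (auto simp: qball_def not_less)
      then have "sep (insert e S)" using S e(1) by (auto simp: sep_def)
      moreover have "e \<notin> S" using e(2) ball_center X x by blast
      ultimately show False using max[of "insert e S"] S by (simp add: sep_def)
    qed
    then show "\<exists>S. finite S \<and> card S \<le> nat \<lfloor>M\<rfloor> \<and> S \<subseteq> E \<and> E \<subseteq> (\<Union>z\<in>S. B z t) \<and>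
        disjoint_family_on (\<lambda>z. B z (t / (2 * K))) S"
      using S card[OF S] disj[OF S] by (auto simp: sep_def u_def)
  qed
qed

lemma powr_vol_le:
  assumes "0 \<le> s" "0 \<le> M" "vol x r \<le> M * vol y t"
  shows "vol x r powr s \<le> M powr s * vol y t powr s"
proof -
  have "vol x r powr s \<le> (M * vol y t) powr s"
    using assms by (intro powr_mono2) (auto simp: vol_def)
  then show ?thesis using assms by (simp add: powr_mult vol_def)
qed

lemma s_bounds_lower:
  assumes "s_bounds X d \<mu> s m c x r" "1 \<le> c"
  shows "ennreal (vol x r powr s) \<le> ennreal c * m (B x r)"
proof -
  have "ennreal (vol x r powr s) = ennreal c * (ennreal (inverse c) * ennreal (vol x r powr s))"
    using assms(2) by (simp flip: ennreal_mult mult.assoc)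
  also have "\<dots> \<le> ennreal c * m (B x r)"
    using assms(1) by (intro mult_left_mono) (auto simp: s_bounds_def mpow_ball)
  finally show ?thesis .
qed

lemma s_bounds_upper:
  "s_bounds X d \<mu> s m c x r \<Longrightarrow> m (B x r) \<le> ennreal c * ennreal (vol x r powr s)"
  by (simp add: s_bounds_def mpow_ball)

subsection \<open>Comparison of the two measures\<close>

text \<open>The constant comes from the disjointness of the shrunken balls inside
  \<open>B x (2 * K * r)\<close>, not from the size of the net, which may grow as
  \<open>\<rho>\<close> tends to 0.\<close>

lemma hausdorff_ball_upper_inner:
  assumes "0 \<le> s" "1 \<le> c" "F \<subseteq> X" and m: "borel_measure X d m"
  obtains C where "0 \<le> C"
    "\<And>x r. x \<in> F \<Longrightarrow> 0 < r \<Longrightarrow>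
      (\<And>z t. z \<in> F \<Longrightarrow> 0 < t \<Longrightarrow> t \<le> 2 * K * r \<Longrightarrow> s_bounds X d \<mu> s m c z t) \<Longrightarrow>
      hausdorff X d \<mu> s (B x r \<inter> F) \<le> ennreal (C * vol x r powr s)"
proof -
  obtain M where M: "1 \<le> M" "\<And>x r. x \<in> X \<Longrightarrow> 0 < r \<Longrightarrow> vol x (2 * K * r) \<le> M * vol x r"
    using dilate[of "2 * K"] K_ge_1 by auto
  \<comment> \<open>The first factor passes from \<open>vol z t powr s\<close> to
    \<open>m (B z u)\<close>, the second from \<open>m (B x (2 * K * r))\<close> to
    \<open>vol x r powr s\<close>.\<close>
  define C where "C = (M powr s * c) * (c * M powr s)"
  have "0 \<le> C" using assms M by (simp add: C_def)
  then show thesis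
  proof (rule that, intro hausdorff_least)
    fix x r and \<rho> :: real
    assume "x \<in> F" "0 < r" "0 < \<rho>"
      and bounds: "\<And>z t. z \<in> F \<Longrightarrow> 0 < t \<Longrightarrow> t \<le> 2 * K * r \<Longrightarrow> s_bounds X d \<mu> s m c z t"
    have x: "x \<in> X" using \<open>x \<in> F\<close> assms by blast
    have K2: "2 * K * u > 0 \<and> u \<le> 2 * K * u" if "0 < u" for u
      using that K_ge_1 mult_right_mono[of 1 "2 * K" u] by simp
    obtain t1 where t1: "0 < t1" "\<And>z. z \<in> B x r \<Longrightarrow> vol z t1 < \<rho>"
      using vol_uniformly_small[OF x \<open>0 < \<rho>\<close>] by blast
    \<comment> \<open>\<open>t \<le> t1\<close> makes the covering balls admissible for
      \<open>\<rho>\<close>, and \<open>t \<le> r\<close> keeps the shrunken ones inside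
      \<open>B x (2 * K * r)\<close>.\<close>
    define t where "t = min t1 r"
    define u where "u = t / (2 * K)"
    have t: "0 < t" "t \<le> r" "t \<le> t1" using t1 \<open>0 < r\<close> by (auto simp: t_def)
    have u: "0 < u" "2 * K * u = t" using t K_ge_1 by (auto simp: u_def)
    then have "u \<le> t" using K2[of u] by simp
    have "1 \<le> r / t" using t by simp
    from net[OF this] obtain n where n: "\<forall>x\<in>X. \<forall>r'>0. \<forall>t'>0. r' \<le> r / t * t' \<longrightarrow> (\<forall>E\<subseteq>B x r'.
        \<exists>S. finite S \<and> card S \<le> n \<and> S \<subseteq> E \<and> E \<subseteq> (\<Union>z\<in>S. B z t') \<and>
          disjoint_family_on (\<lambda>z. B z (t' / (2 * K))) S)"
      by (rule exE)
    obtain S where S: "finite S" "S \<subseteq> B x r \<inter> F" "B x r \<inter> F \<subseteq> (\<Union>z\<in>S. B z t)"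
      "disjoint_family_on (\<lambda>z. B z u) S"
      using n[rule_format, OF x \<open>0 < r\<close> t(1) _ inf_le1[of "B x r" F]] t(1) by (auto simp: u_def)
    have SX: "z \<in> X" "z \<in> F" "z \<in> B x r" if "z \<in> S" for z
      using that S assms by auto
    have "hausdorff_pre X d \<mu> s \<rho> (B x r \<inter> F) \<le> (\<Sum>\<^sub>\<infinity>z\<in>S. mpow \<mu> s (B z t))"
    proof (rule hausdorff_pre_le)
      fix z assume z: "z \<in> S"
      have "vol z t \<le> vol z t1" using SX[OF z] t t1 by (intro vol_mono ball_mono) auto
      also have "\<dots> \<le> \<rho>" using t1 SX[OF z] by (simp add: less_imp_le)
      finally show "z \<in> X \<and> 0 < t \<and> \<mu> (B z t) \<le> ennreal \<rho>"
        using SX[OF z] t by (simp add: measure_ball ennreal_leI)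
    qed (use S in \<open>auto intro: countable_finite\<close>)
    also have "\<dots> = (\<Sum>z\<in>S. ennreal (vol z t powr s))" using S by (simp add: mpow_ball)
    also have "\<dots> \<le> (\<Sum>z\<in>S. ennreal (M powr s * c) * m (B z u))"
    proof (rule sum_mono)
      fix z assume z: "z \<in> S"
      have "vol z t \<le> M * vol z u" using M(2)[OF SX(1)[OF z] u(1)] u(2) by simp
      then have "ennreal (vol z t powr s) \<le> ennreal (M powr s) * ennreal (vol z u powr s)"
        using powr_vol_le[of s M z t z u] assms M by (simp add: ennreal_leI flip: ennreal_mult)
      also have "\<dots> \<le> ennreal (M powr s) * (ennreal c * m (B z u))"
      proof -
        have "u \<le> 2 * K * r" using \<open>u \<le> t\<close> t K2[OF \<open>0 < r\<close>] by linarith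
        then show ?thesis
          using bounds SX[OF z] u assms by (intro mult_left_mono s_bounds_lower) auto
      qed
      finally show "ennreal (vol z t powr s) \<le> ennreal (M powr s * c) * m (B z u)"
        using assms by (simp add: ennreal_mult mult.assoc)
    qed
    also have "\<dots> = ennreal (M powr s * c) * (\<Sum>z\<in>S. m (B z u))" by (simp add: sum_distrib_left)
    also have "(\<Sum>z\<in>S. m (B z u)) \<le> m (B x (2 * K * r))"
    proof (rule sum_disjoint_balls_le[OF m])
      fix z assume z: "z \<in> S"
      have "K * (r + u) \<le> K * (r + r)"
        using \<open>u \<le> t\<close> t K_ge_1 by (intro mult_left_mono) auto
      then show "B z u \<subseteq> B x (2 * K * r)"
        using SX[OF z] x by (intro ball_subset_trans[of x z r]) auto
    qed (use S SX u x K2 \<open>0 < r\<close> in auto)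
    also have "m (B x (2 * K * r)) \<le> ennreal c * ennreal (vol x (2 * K * r) powr s)"
      using bounds \<open>x \<in> F\<close> K2 \<open>0 < r\<close> by (intro s_bounds_upper) auto
    also have "ennreal (vol x (2 * K * r) powr s) \<le> ennreal (M powr s * vol x r powr s)"
      using M x \<open>0 < r\<close> assms by (intro ennreal_leI powr_vol_le) auto
    finally show "hausdorff_pre X d \<mu> s \<rho> (B x r \<inter> F) \<le> ennreal (C * vol x r powr s)"
      using assms by (simp add: C_def mult.assoc mult_left_mono flip: ennreal_mult)
  qed
qed

text \<open>
  The previous bound uses the regularity of \<open>m\<close> at scales up to \<open>2 * K * r\<close>. Covering the ball by
  boundedly many balls of radius \<open>r / (2 * K)\<close> centred in \<open>F\<close> brings this down to \<open>r\<close>, which matters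
  for radii just below the diameter of \<open>F\<close>.
\<close>

lemma hausdorff_ball_upper:
  assumes "0 \<le> s" "1 \<le> c" "F \<subseteq> X" and m: "borel_measure X d m"
  obtains C where "0 \<le> C"
    "\<And>x r. x \<in> F \<Longrightarrow> 0 < r \<Longrightarrow>
      (\<And>z t. z \<in> F \<Longrightarrow> 0 < t \<Longrightarrow> t \<le> r \<Longrightarrow> s_bounds X d \<mu> s m c z t) \<Longrightarrow>
      hausdorff X d \<mu> s (B x r \<inter> F) \<le> ennreal (C * vol x r powr s)"
proof -
  obtain C where C: "0 \<le> C"
    "\<And>x r. x \<in> F \<Longrightarrow> 0 < r \<Longrightarrow>
      (\<And>z t. z \<in> F \<Longrightarrow> 0 < t \<Longrightarrow> t \<le> 2 * K * r \<Longrightarrow> s_bounds X d \<mu> s m c z t) \<Longrightarrow>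
      hausdorff X d \<mu> s (B x r \<inter> F) \<le> ennreal (C * vol x r powr s)"
    using hausdorff_ball_upper_inner[OF assms] by blast
  have "1 \<le> 2 * K" using K_ge_1 by simp
  from net[OF this] obtain n where n: "\<forall>x\<in>X. \<forall>r>0. \<forall>t>0. r \<le> 2 * K * t \<longrightarrow> (\<forall>E\<subseteq>B x r.
      \<exists>S. finite S \<and> card S \<le> n \<and> S \<subseteq> E \<and> E \<subseteq> (\<Union>z\<in>S. B z t) \<and>
        disjoint_family_on (\<lambda>z. B z (t / (2 * K))) S)"
    by (rule exE)
  obtain M where M: "1 \<le> M"
    "\<And>x y r t. x \<in> X \<Longrightarrow> y \<in> X \<Longrightarrow> 0 < r \<Longrightarrow> 0 < t \<Longrightarrow> B x r \<inter> B y t \<noteq> {} \<Longrightarrow> r \<le> 1 * t \<Longrightarrow>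
      vol x r \<le> M * vol y t"
    using comparable[of 1] by auto
  \<comment> \<open>At most \<open>n\<close> small balls occur, and each has measure at most
    \<open>M\<close> times that of \<open>B x r\<close>.\<close>
  have nonneg: "0 \<le> real n * (C * M powr s)" using C(1) by simp
  then show thesis
  proof (rule that)
    fix x r
    assume "x \<in> F" "0 < r"
      and bounds: "\<And>z t. z \<in> F \<Longrightarrow> 0 < t \<Longrightarrow> t \<le> r \<Longrightarrow> s_bounds X d \<mu> s m c z t"
    have x: "x \<in> X" using \<open>x \<in> F\<close> assms by blast
    define t where "t = r / (2 * K)"
    have t: "0 < t" "2 * K * t = r" using K_ge_1 \<open>0 < r\<close> by (auto simp: t_def)
    have "t \<le> r" using mult_right_mono[of 1 "2 * K" t] t K_ge_1 by simp
    obtain S where S: "finite S" "card S \<le> n" "S \<subseteq> B x r \<inter> F" "B x r \<inter> F \<subseteq> (\<Union>z\<in>S. B z t)"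
      using n[rule_format, OF x \<open>0 < r\<close> t(1) _ inf_le1[of "B x r" F]] t(2) by auto
    have "hausdorff X d \<mu> s (B x r \<inter> F) \<le> hausdorff X d \<mu> s (\<Union>z\<in>S. B z t \<inter> F)"
      using S by (intro hausdorff_mono) blast
    also have "\<dots> \<le> (\<Sum>z\<in>S. hausdorff X d \<mu> s (B z t \<inter> F))"
      using S(1) by (rule hausdorff_finite_UN_le)
    also have "\<dots> \<le> (\<Sum>z\<in>S. ennreal (C * M powr s * vol x r powr s))"
    proof (rule sum_mono)
      fix z assume z: "z \<in> S"
      have zF: "z \<in> F" "z \<in> B x r" "z \<in> X" using z S assms by auto
      have "hausdorff X d \<mu> s (B z t \<inter> F) \<le> ennreal (C * vol z t powr s)"
        using zF t bounds by (intro C(2)) auto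
      also have "\<dots> \<le> ennreal (C * (M powr s * vol x r powr s))"
      proof (intro ennreal_leI mult_left_mono powr_vol_le)
        show "vol z t \<le> M * vol x r"
          using zF x t \<open>0 < r\<close> \<open>t \<le> r\<close> ball_center[of z t] by (intro M(2)) auto
      qed (use assms M C in auto)
      finally show "hausdorff X d \<mu> s (B z t \<inter> F) \<le> ennreal (C * M powr s * vol x r powr s)"
        by (simp add: mult.assoc)
    qed
    also have "\<dots> = ennreal (\<Sum>z\<in>S. C * M powr s * vol x r powr s)"
      using C(1) by (intro sum_ennreal) auto
    also have "\<dots> \<le> ennreal (real n * (C * M powr s) * vol x r powr s)"
      using S(2) C(1) by (intro ennreal_leI) (simp add: mult.assoc mult_right_mono)
    finally show "hausdorff X d \<mu> s (B x r \<inter> F) \<le> ennreal (real n * (C * M powr s) * vol x r powr s)" .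
  qed
qed

text \<open>A mass distribution argument: a covering ball that meets \<open>B x r \<inter> F\<close>
  lies in a comparable ball centred in \<open>F\<close>, so its \<open>m\<close>-mass is at most a
  constant times its contribution to the sum.\<close>

lemma hausdorff_ball_lower:
  assumes "0 \<le> s" "1 \<le> c" "F \<subseteq> X" "F \<in> borel_sets X d"
    and m: "borel_measure X d m" "m (X - F) = 0"
  obtains C where "1 \<le> C"
    "\<And>x r. x \<in> F \<Longrightarrow> 0 < r \<Longrightarrow>
      (\<And>z t. z \<in> F \<Longrightarrow> 0 < t \<Longrightarrow> t \<le> r \<Longrightarrow> s_bounds X d \<mu> s m c z t) \<Longrightarrow>
      ennreal (inverse C) * ennreal (vol x r powr s) \<le> hausdorff X d \<mu> s (B x r \<inter> F)"
proof -
  interpret sigma_algebra X "borel_sets X d" by (rule sigma_algebra_borel_sets)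
  obtain N where N: "sets N = borel_sets X d" "\<And>E. E \<in> borel_sets X d \<Longrightarrow> emeasure N E = m E"
    using borel_measureE[OF m(1)] by blast
  obtain M where M: "1 \<le> M"
    "\<And>x y r t. x \<in> X \<Longrightarrow> y \<in> X \<Longrightarrow> 0 < r \<Longrightarrow> 0 < t \<Longrightarrow> B x r \<inter> B y t \<noteq> {} \<Longrightarrow> r \<le> 2 * K * t \<Longrightarrow>
      vol x r \<le> M * vol y t"
    using comparable[of "2 * K"] K_ge_1 by auto
  \<comment> \<open>One \<open>c\<close> is from the lower bound on \<open>m (B x r)\<close>;
    \<open>c * M powr s\<close> is from the upper bound on recentred balls.\<close>
  define C where "C = c * (c * M powr s)"
  have "1 \<le> M powr s" using M assms by (intro ge_one_powr_ge_zero)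
  then have "1 \<le> C"
    using mult_mono[of 1 c 1 "c * M powr s"] mult_mono[of 1 c 1 "M powr s"] assms by (simp add: C_def)
  then show thesis
  proof (rule that)
    fix x r
    assume "x \<in> F" "0 < r"
      and bounds: "\<And>z t. z \<in> F \<Longrightarrow> 0 < t \<Longrightarrow> t \<le> r \<Longrightarrow> s_bounds X d \<mu> s m c z t"
    have x: "x \<in> X" using \<open>x \<in> F\<close> assms by blast
    \<comment> \<open>Small enough that a covering ball comparable to \<open>B x r\<close> would be
      too large in measure; this forces the recentred radii to stay at most
      \<open>r\<close>.\<close>
    define \<rho> where "\<rho> = vol x r / (2 * M)"
    have "0 < \<rho>" using vol_pos[OF x \<open>0 < r\<close>] M by (simp add: \<rho>_def)
    have "M * \<rho> < vol x r" using vol_pos[OF x \<open>0 < r\<close>] M by (simp add: \<rho>_def)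
    have "ennreal (inverse C) * ennreal (vol x r powr s) \<le> hausdorff_pre X d \<mu> s \<rho> (B x r \<inter> F)"
    proof (rule hausdorff_pre_greatest)
      fix I :: "nat set" and y t
      assume I: "\<And>i. i \<in> I \<Longrightarrow> y i \<in> X \<and> 0 < t i \<and> \<mu> (B (y i) (t i)) \<le> ennreal \<rho>"
        and cover: "B x r \<inter> F \<subseteq> (\<Union>i\<in>I. B (y i) (t i))"
      define J where "J = {i\<in>I. B (y i) (t i) \<inter> (B x r \<inter> F) \<noteq> {}}"
      \<comment> \<open>Only balls meeting \<open>B x r \<inter> F\<close> can be recentred; the
        others are replaced by the empty set, so that the family runs over all of
        \<open>nat\<close>.\<close>
      define G where "G i = (if i \<in> J then B (y i) (t i) else {})" for i
      let ?f = "\<lambda>i. mpow \<mu> s (B (y i) (t i))"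
      have G_sets: "G i \<in> borel_sets X d" for i
        using I qball_borel by (auto simp: G_def J_def)
      have G_le: "m (G i) \<le> ennreal (c * M powr s) * (if i \<in> I then ?f i else 0)" for i
      proof (cases "i \<in> J")
        case True
        then obtain z where i: "i \<in> I" and z: "z \<in> B (y i) (t i)" "z \<in> B x r" "z \<in> F"
          by (auto simp: J_def)
        have y: "y i \<in> X" "0 < t i" and "\<mu> (B (y i) (t i)) \<le> ennreal \<rho>" using I[OF i] by auto
        then have "vol (y i) (t i) \<le> \<rho>"
          using \<open>0 < \<rho>\<close> by (simp add: measure_ball ennreal_le_iff)
        have zX: "z \<in> X" using z assms by blast
        define u where "u = 2 * K * t i"
        have u: "0 < u" using y K_ge_1 by (simp add: u_def)
        have "u \<le> r"
        proof (rule ccontr)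
          assume "\<not> u \<le> r"
          then have "vol x r \<le> M * vol (y i) (t i)"
            using x y z \<open>0 < r\<close> by (intro M(2)) (auto simp: u_def)
          also have "\<dots> \<le> M * \<rho>" using \<open>vol (y i) (t i) \<le> \<rho>\<close> M by (intro mult_left_mono) auto
          finally show False using \<open>M * \<rho> < vol x r\<close> by simp
        qed
        have "B (y i) (t i) \<subseteq> B z u"
          using zX y z in_ball_sym by (intro ball_subset_trans[of z "y i" "t i"]) (auto simp: u_def)
        then have "emeasure N (B (y i) (t i)) \<le> emeasure N (B z u)"
          using zX u qball_borel N by (intro emeasure_mono) auto
        then have "m (B (y i) (t i)) \<le> m (B z u)" using zX u y qball_borel N by simp
        also have "\<dots> \<le> ennreal c * ennreal (vol z u powr s)"
          using bounds z u \<open>u \<le> r\<close> by (intro s_bounds_upper) auto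
        also have "ennreal (vol z u powr s) \<le> ennreal (M powr s * vol (y i) (t i) powr s)"
        proof (intro ennreal_leI powr_vol_le)
          show "vol z u \<le> M * vol (y i) (t i)"
            using zX y u z ball_center[OF zX u] by (intro M(2)) (auto simp: u_def)
        qed (use assms M in auto)
        finally show ?thesis
          using True i assms by (simp add: G_def mpow_ball mult_left_mono mult.assoc flip: ennreal_mult)
      next
        case False
        have "m {} = 0" using m(1) by (simp add: borel_measure_def measure_space_def positive_def)
        with False show ?thesis by (simp add: G_def)
      qed
      have "m (B x r) = emeasure N (B x r)" using N qball_borel x \<open>0 < r\<close> by simp
      \<comment> \<open>The cover reaches only \<open>B x r \<inter> F\<close>; the rest of the ball
        lies in \<open>X - F\<close>, which is null for \<open>m\<close>.\<close>
      also have "\<dots> \<le> emeasure N ((\<Union>i. G i) \<union> (X - F))"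
      proof (rule emeasure_mono)
        show "B x r \<subseteq> (\<Union>i. G i) \<union> (X - F)"
        proof
          fix z assume z: "z \<in> B x r"
          show "z \<in> (\<Union>i. G i) \<union> (X - F)"
          proof (cases "z \<in> F")
            case True
            then obtain i where "i \<in> I" "z \<in> B (y i) (t i)" using cover z by blast
            then have "z \<in> G i" using z True by (auto simp: G_def J_def)
            then show ?thesis by blast
          qed (use z in \<open>auto simp: qball_def\<close>)
        qed
        show "(\<Union>i. G i) \<union> (X - F) \<in> sets N" unfolding N(1) using G_sets assms by auto
      qed
      also have "\<dots> \<le> emeasure N (\<Union>i. G i) + emeasure N (X - F)"
        using G_sets assms N by (intro emeasure_subadditive) auto
      also have "\<dots> = emeasure N (\<Union>i. G i)" using N(2)[OF compl_sets[OF assms(4)]] m(2) by simp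
      also have "\<dots> \<le> (\<Sum>i. emeasure N (G i))"
        using G_sets N by (intro emeasure_subadditive_countably) auto
      also have "\<dots> \<le> (\<Sum>i. ennreal (c * M powr s) * (if i \<in> I then ?f i else 0))"
        using G_le G_sets N by (intro suminf_le) auto
      also have "\<dots> = ennreal (c * M powr s) * (\<Sum>\<^sub>\<infinity>i\<in>I. ?f i)"
        by (simp add: infsum_nat_ennreal)
      finally have "m (B x r) \<le> ennreal (c * M powr s) * (\<Sum>\<^sub>\<infinity>i\<in>I. ?f i)" .
      then have "ennreal c * m (B x r) \<le> ennreal c * (ennreal (c * M powr s) * (\<Sum>\<^sub>\<infinity>i\<in>I. ?f i))"
        by (rule mult_left_mono) simp
      moreover have "ennreal (vol x r powr s) \<le> ennreal c * m (B x r)"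
        using bounds[of x r] \<open>x \<in> F\<close> \<open>0 < r\<close> assms by (intro s_bounds_lower) auto
      ultimately have "ennreal (vol x r powr s) \<le> ennreal C * (\<Sum>\<^sub>\<infinity>i\<in>I. ?f i)"
        using assms by (simp add: C_def ennreal_mult mult.assoc)
      then have "ennreal (inverse C) * ennreal (vol x r powr s)
          \<le> ennreal (inverse C) * (ennreal C * (\<Sum>\<^sub>\<infinity>i\<in>I. ?f i))"
        by (rule mult_left_mono) simp
      also have "\<dots> = (\<Sum>\<^sub>\<infinity>i\<in>I. ?f i)"
        using \<open>1 \<le> C\<close> by (simp flip: mult.assoc ennreal_mult)
      finally show "ennreal (inverse C) * ennreal (vol x r powr s) \<le> (\<Sum>\<^sub>\<infinity>i\<in>I. ?f i)" .
    qed
    also have "\<dots> \<le> hausdorff X d \<mu> s (B x r \<inter> F)"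
      using \<open>0 < \<rho>\<close> by (rule hausdorff_pre_le_hausdorff)
    finally show "ennreal (inverse C) * ennreal (vol x r powr s) \<le> hausdorff X d \<mu> s (B x r \<inter> F)" .
  qed
qed

section \<open>Transfer of the regularity bounds\<close>

text \<open>The bounds for \<open>m\<close> are assumed only at scales up to \<open>r\<close>, while
  \<open>C\<close> is independent of \<open>x\<close> and \<open>r\<close>; thus one statement
  serves the global and the local case.\<close>

lemma s_bounds_hausdorff:
  assumes "0 \<le> s" "1 \<le> c" "closedin (qtopology X d) F"
    and m: "borel_measure X d m" "m (X - F) = 0"
  obtains C where "1 \<le> C"
    "\<And>x r. x \<in> F \<Longrightarrow> 0 < r \<Longrightarrow>
      (\<And>z t. z \<in> F \<Longrightarrow> 0 < t \<Longrightarrow> t \<le> r \<Longrightarrow> s_bounds X d \<mu> s m c z t) \<Longrightarrow>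
      s_bounds X d \<mu> s (\<lambda>E. hausdorff X d \<mu> s (E \<inter> F)) C x r"
proof -
  have F: "F \<subseteq> X" "F \<in> borel_sets X d"
    using assms(3) closedin_borel_sets by (auto simp: closedin_def topspace_qtopology)
  obtain C1 where C1: "0 \<le> C1"
    "\<And>x r. x \<in> F \<Longrightarrow> 0 < r \<Longrightarrow>
      (\<And>z t. z \<in> F \<Longrightarrow> 0 < t \<Longrightarrow> t \<le> r \<Longrightarrow> s_bounds X d \<mu> s m c z t) \<Longrightarrow>
      hausdorff X d \<mu> s (B x r \<inter> F) \<le> ennreal (C1 * vol x r powr s)"
    using hausdorff_ball_upper[OF assms(1,2) F(1) m(1)] by blast
  obtain C2 where C2: "1 \<le> C2"
    "\<And>x r. x \<in> F \<Longrightarrow> 0 < r \<Longrightarrow>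
      (\<And>z t. z \<in> F \<Longrightarrow> 0 < t \<Longrightarrow> t \<le> r \<Longrightarrow> s_bounds X d \<mu> s m c z t) \<Longrightarrow>
      ennreal (inverse C2) * ennreal (vol x r powr s) \<le> hausdorff X d \<mu> s (B x r \<inter> F)"
    using hausdorff_ball_lower[OF assms(1,2) F m] by blast
  show thesis
  proof (rule that[of "max C1 C2"])
    show "1 \<le> max C1 C2" using C2(1) by simp
    fix x r
    assume x: "x \<in> F" "0 < r"
      and bounds: "\<And>z t. z \<in> F \<Longrightarrow> 0 < t \<Longrightarrow> t \<le> r \<Longrightarrow> s_bounds X d \<mu> s m c z t"
    have "ennreal (inverse (max C1 C2)) * ennreal (vol x r powr s)
        \<le> ennreal (inverse C2) * ennreal (vol x r powr s)"
      using C2(1) by (intro mult_right_mono ennreal_leI le_imp_inverse_le) auto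
    also have "\<dots> \<le> hausdorff X d \<mu> s (B x r \<inter> F)" using C2(2)[OF x bounds] .
    finally have lower: "ennreal (inverse (max C1 C2)) * ennreal (vol x r powr s)
        \<le> hausdorff X d \<mu> s (B x r \<inter> F)" .
    have "hausdorff X d \<mu> s (B x r \<inter> F) \<le> ennreal C1 * ennreal (vol x r powr s)"
      using C1(2)[OF x bounds] C1(1) by (simp add: ennreal_mult)
    also have "\<dots> \<le> ennreal (max C1 C2) * ennreal (vol x r powr s)"
      by (intro mult_right_mono ennreal_leI) auto
    finally show "s_bounds X d \<mu> s (\<lambda>E. hausdorff X d \<mu> s (E \<inter> F)) (max C1 C2) x r"
      using lower by (simp add: s_bounds_def mpow_ball)
  qed
qed

lemma borel_measure_hausdorff_restrict:
  assumes "closedin (qtopology X d) F"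
  shows "borel_measure X d (\<lambda>E. hausdorff X d \<mu> s (E \<inter> F))"
  using borel_measure_hausdorff closedin_borel_sets[OF assms] by (rule borel_measure_restrict)

lemma hausdorff_restrict_Diff: "hausdorff X d \<mu> s ((X - F) \<inter> F) = 0"
proof -
  have "(X - F) \<inter> F = {}" by blast
  then show ?thesis by (simp add: hausdorff_empty)
qed

lemma s_set_hausdorff:
  assumes "0 \<le> s" "s_set X d \<mu> s F m"
  shows "s_set X d \<mu> s F (\<lambda>E. hausdorff X d \<mu> s (E \<inter> F))"
proof -
  from assms(2) obtain c where F: "closedin (qtopology X d) F"
    and m: "borel_measure X d m" "m (X - F) = 0" and c: "1 \<le> c"
    and bounds: "\<And>x r. x \<in> F \<Longrightarrow> 0 < r \<Longrightarrow> ennreal r < qdiam d F \<Longrightarrow> s_bounds X d \<mu> s m c x r"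
    unfolding s_set_def by blast
  obtain C where C: "1 \<le> C"
    "\<And>x r. x \<in> F \<Longrightarrow> 0 < r \<Longrightarrow>
      (\<And>z t. z \<in> F \<Longrightarrow> 0 < t \<Longrightarrow> t \<le> r \<Longrightarrow> s_bounds X d \<mu> s m c z t) \<Longrightarrow>
      s_bounds X d \<mu> s (\<lambda>E. hausdorff X d \<mu> s (E \<inter> F)) C x r"
    using s_bounds_hausdorff[OF assms(1) c F m] by blast
  have "s_bounds X d \<mu> s (\<lambda>E. hausdorff X d \<mu> s (E \<inter> F)) C x r"
    if "x \<in> F" "0 < r" "ennreal r < qdiam d F" for x r
    using that(1,2)
  proof (rule C(2))
    fix z t assume "z \<in> F" "0 < t" "t \<le> r"
    then show "s_bounds X d \<mu> s m c z t"
      using that(3) by (intro bounds) (auto intro: le_less_trans ennreal_leI)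
  qed
  then show ?thesis
    unfolding s_set_def
    using F C(1) borel_measure_hausdorff_restrict[OF F] hausdorff_restrict_Diff by blast
qed

text \<open>The same \<open>r\<^sub>0\<close> works, since the bounds at \<open>r\<close> use only
  smaller or equal scales.\<close>

lemma local_s_set_hausdorff:
  assumes "0 \<le> s" "local_s_set X d \<mu> s F m"
  shows "local_s_set X d \<mu> s F (\<lambda>E. hausdorff X d \<mu> s (E \<inter> F))"
proof -
  from assms(2) obtain r\<^sub>0 c where F: "closedin (qtopology X d) F"
    and m: "borel_measure X d m" "m (X - F) = 0" and c: "1 \<le> c"
    and r\<^sub>0: "0 < r\<^sub>0" "ennreal r\<^sub>0 < qdiam d F"
    and bounds: "\<And>x r. x \<in> F \<Longrightarrow> 0 < r \<Longrightarrow> r < r\<^sub>0 \<Longrightarrow> s_bounds X d \<mu> s m c x r"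
    unfolding local_s_set_def by blast
  obtain C where C: "1 \<le> C"
    "\<And>x r. x \<in> F \<Longrightarrow> 0 < r \<Longrightarrow>
      (\<And>z t. z \<in> F \<Longrightarrow> 0 < t \<Longrightarrow> t \<le> r \<Longrightarrow> s_bounds X d \<mu> s m c z t) \<Longrightarrow>
      s_bounds X d \<mu> s (\<lambda>E. hausdorff X d \<mu> s (E \<inter> F)) C x r"
    using s_bounds_hausdorff[OF assms(1) c F m] by blast
  have "s_bounds X d \<mu> s (\<lambda>E. hausdorff X d \<mu> s (E \<inter> F)) C x r"
    if "x \<in> F" "0 < r" "r < r\<^sub>0" for x r
    using that by (intro C(2) bounds) auto
  then show ?thesis
    unfolding local_s_set_def
    using F C(1) r\<^sub>0 borel_measure_hausdorff_restrict[OF F] hausdorff_restrict_Diff by blast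
qed

end

lemma homogeneous_typeE:
  assumes "homogeneous_type X d \<mu>"
  obtains K A where "homogeneous_space X d \<mu> K A"
proof -
  have dist: "\<forall>x\<in>X. \<forall>y\<in>X. 0 \<le> d x y \<and> (d x y = 0 \<longleftrightarrow> x = y) \<and> d x y = d y x"
    and open_ball: "\<forall>x\<in>X. \<forall>r>0. openin (qtopology X d) (qball X d x r)"
    and \<mu>: "borel_measure X d \<mu>" "\<forall>x\<in>X. \<mu> {x} = 0"
    using assms by (auto simp: homogeneous_type_def quasi_metric_def)
  obtain K where K: "1 \<le> K" "\<forall>x\<in>X. \<forall>y\<in>X. \<forall>z\<in>X. d x y \<le> K * (d x z + d z y)"
    using assms by (auto simp: homogeneous_type_def quasi_metric_def)
  obtain A :: real where A: "1 \<le> A" and dbl: "\<forall>x\<in>X. \<forall>r>0.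
        0 < \<mu> (qball X d x (2 * r)) \<and>
        \<mu> (qball X d x (2 * r)) \<le> ennreal A * \<mu> (qball X d x r) \<and>
        ennreal A * \<mu> (qball X d x r) < \<infinity>"
    using assms by (auto simp: homogeneous_type_def doubling_def)
  have "homogeneous_space X d \<mu> K A"
  proof
    fix x and r :: real assume x: "x \<in> X" "0 < r"
    \<comment> \<open>\<open>doubling\<close> states positivity for radius \<open>2 * r\<close>,
      hence the instance at \<open>r / 2\<close>.\<close>
    show "0 < \<mu> (qball X d x r)" using dbl[rule_format, of x "r / 2"] x by simp
    have "ennreal A * \<mu> (qball X d x r) < top" using dbl x by simp
    then show "\<mu> (qball X d x r) < top"
      using A by (auto simp: ennreal_mult_less_top ennreal_eq_0_iff)
  qed (use dist open_ball \<mu> K A dbl in \<open>auto\<close>)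
  then show thesis by (rule that)
qed

theorem proposition2p6:
  fixes X :: "'a set" and d :: "'a \<Rightarrow> 'a \<Rightarrow> real" and \<mu> :: "'a set \<Rightarrow> ennreal"
    and s :: real and F :: "'a set"
  assumes "homogeneous_type X d \<mu>"
    and "0 \<le> s"
    and "closedin (qtopology X d) F"
  shows "((\<exists>m. s_set X d \<mu> s F m) \<longrightarrow> s_set X d \<mu> s F (\<lambda>E. hausdorff X d \<mu> s (E \<inter> F))) \<and>
         ((\<exists>m. local_s_set X d \<mu> s F m) \<longrightarrow> local_s_set X d \<mu> s F (\<lambda>E. hausdorff X d \<mu> s (E \<inter> F)))"
proof -
  obtain K A where "homogeneous_space X d \<mu> K A"
    using homogeneous_typeE[OF assms(1)] .
  then interpret homogeneous_space X d \<mu> K A .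
  show ?thesis
    using s_set_hausdorff[OF assms(2)] local_s_set_hausdorff[OF assms(2)] by blast
qed

end
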